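(* The spheres $\mathbb S^{239}$ and $\mathbb S^{30000}$ satisfy $$d_{\mathrm{GH}}(\mathbb S^{239},\mathbb S^{30000})\ \ge\ \tfrac12 d_{\mathrm I}^{\chi}(\mathbb S^{239},\mathbb S^{30000})\ \ge\ \frac{289\pi}{800}\ >\ \frac\pi3\ >\ \tfrac12c_{239,30000}.$$
   Context: For $m\ge1$, $\mathbb S^m\subset\mathbb R^{m+1}$ is the unit round sphere with geodesic metric $\arccos\langle x,x'\rangle$; $\mathbb S^0$ is two points at distance $\pi$. $d_{\mathrm{GH}}$ is the Gromov--Hausdorff distance between compact metric spaces (half the infimum of distortions of correspondences). For a nonempty metric space $X$ and $s>0$, $\mathrm{Bor}_{\ge s}(X)$ is the simple graph with vertex set $X$ in which distinct points are adjacent exactly when their distance is at least $s$, and $\chi_X(s):=\chi(\mathrm{Bor}_{\ge s}(X))$ is its chromatic number (finite for totally bounded $X$). $d_{\mathrm I}^{\chi}(X,Y)$ is the infimum of the $\delta\ge0$ such that, for every $u>\delta$, $\chi_X(u)\le\chi_Y(u-\delta)$ and $\chi_Y(u)\le\chi_X(u-\delta)$. The group $C_2$ of order two acts antipodally on each sphere; a map between $C_2$-spaces is odd if it is $C_2$-equivariant. The coindex of a $C_2$-space $X$ is $\mathrm{coind}(X):=\sup\{k\ge0:\text{there is a continuous odd map }\mathbb S^k\to X\}$. $\mathrm{VR}(X;r)$ is the geometric realization of the simplicial complex with vertex set $X$ whose simplices are the nonempty finite subsets of diameter at most $r$; $\mathrm{VR}(\mathbb S^m;r)$ carries the $C_2$-action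 induced by the antipodal map. For integers $0\le m\le n$, $c_{m,n}:=\inf\{r\ge0:\mathrm{coind}(\mathrm{VR}(\mathbb S^m;r))\ge n\}$. *)

theory Defs
  imports
    "HOL-Analysis.Analysis"
    "HOL-Library.Extended_Nat"
    "HOL-Library.Extended_Real"
begin

section \<open>Round spheres\<close>

text \<open>
  The point set is that of the library's \<open>nsphere m\<close>: sequences of reals that vanish
  beyond index \<open>m\<close> and have Euclidean norm 1.  For \<open>m = 0\<close> these are two points,
  at geodesic distance \<open>arccos (- 1) = pi\<close>.  Off the sphere the value 0 is
  immaterial; it is there because \<open>Metric_space\<close> requires nonnegativity on the whole type.
\<close>

definition geodesic_dist :: "nat \<Rightarrow> (nat \<Rightarrow> real) \<Rightarrow> (nat \<Rightarrow> real) \<Rightarrow> real" where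
  "geodesic_dist m x y =
     (if x \<in> topspace (nsphere m) \<and> y \<in> topspace (nsphere m)
      then arccos (\<Sum>i\<le>m. x i * y i) else 0)"

definition round_sphere :: "nat \<Rightarrow> (nat \<Rightarrow> real) metric" where
  "round_sphere m = metric (topspace (nsphere m), geodesic_dist m)"

definition antipode :: "(nat \<Rightarrow> real) \<Rightarrow> (nat \<Rightarrow> real)" where
  "antipode x = (\<lambda>i. - x i)"

lemma mem_nsphere:
  "x \<in> topspace (nsphere m) \<longleftrightarrow> (\<forall>i>m. x i = 0) \<and> (\<Sum>i\<le>m. (x i)\<^sup>2) = 1"
  by (auto simp: nsphere_def topspace_Euclidean_space)

lemma antipode_nsphere: "x \<in> topspace (nsphere m) \<Longrightarrow> antipode x \<in> topspace (nsphere m)"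
  by (simp add: mem_nsphere antipode_def)

lemma nsphere_inner_bounds:
  assumes "x \<in> topspace (nsphere m)" "y \<in> topspace (nsphere m)"
  shows "-1 \<le> (\<Sum>i\<le>m. x i * y i)" "(\<Sum>i\<le>m. x i * y i) \<le> 1"
proof -
  have "(\<Sum>i\<le>m. x i * y i)\<^sup>2 \<le> (\<Sum>i\<le>m. (x i)\<^sup>2) * (\<Sum>i\<le>m. (y i)\<^sup>2)"
    by (rule Cauchy_Schwarz_ineq_sum)
  then have "(\<Sum>i\<le>m. x i * y i)\<^sup>2 \<le> 1"
    using assms by (simp add: mem_nsphere)
  then have "\<bar>\<Sum>i\<le>m. x i * y i\<bar> \<le> 1"
    by (simp add: abs_square_le_1)
  then show "-1 \<le> (\<Sum>i\<le>m. x i * y i)" "(\<Sum>i\<le>m. x i * y i) \<le> 1"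
    by auto
qed

lemma geodesic_triangle:
  assumes x: "x \<in> topspace (nsphere m)" and y: "y \<in> topspace (nsphere m)"
    and z: "z \<in> topspace (nsphere m)"
  shows "geodesic_dist m x z \<le> geodesic_dist m x y + geodesic_dist m y z"
proof -
  define a where "a = (\<Sum>i\<le>m. x i * y i)"
  define b where "b = (\<Sum>i\<le>m. y i * z i)"
  define c where "c = (\<Sum>i\<le>m. x i * z i)"
  have ab: "-1 \<le> a" "a \<le> 1" "-1 \<le> b" "b \<le> 1" "-1 \<le> c" "c \<le> 1"
    unfolding a_def b_def c_def using nsphere_inner_bounds x y z by blast+
  have nx: "(\<Sum>i\<le>m. (x i)\<^sup>2) = 1" and ny: "(\<Sum>i\<le>m. (y i)\<^sup>2) = 1" and nz: "(\<Sum>i\<le>m. (z i)\<^sup>2) = 1"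
    using x y z by (auto simp: mem_nsphere)
  have 1: "(\<Sum>i\<le>m. (x i - a * y i) * (z i - b * y i)) = c - a * b"
  proof -
    have "(\<Sum>i\<le>m. (x i - a * y i) * (z i - b * y i))
        = (\<Sum>i\<le>m. x i * z i - b * (x i * y i) - a * (y i * z i) + a * b * (y i)\<^sup>2)"
      by (intro sum.cong) (auto simp: algebra_simps power2_eq_square)
    also have "\<dots> = c - b * a - a * b + a * b * 1"
      unfolding ny[symmetric] by (simp only: sum.distrib sum_subtractf sum_distrib_left[symmetric] a_def b_def c_def)
    finally show ?thesis by simp
  qed
  have 2: "(\<Sum>i\<le>m. (x i - a * y i)\<^sup>2) = 1 - a\<^sup>2"
  proof -
    have "(\<Sum>i\<le>m. (x i - a * y i)\<^sup>2)
        = (\<Sum>i\<le>m. (x i)\<^sup>2 - (2 * a) * (x i * y i) + a\<^sup>2 * (y i)\<^sup>2)"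
      by (intro sum.cong) (auto simp: algebra_simps power2_eq_square)
    also have "\<dots> = 1 - 2 * a * a + a\<^sup>2 * 1"
      by (simp only: sum.distrib sum_subtractf sum_distrib_left[symmetric] nx ny a_def[symmetric])
    finally show ?thesis by (simp add: power2_eq_square)
  qed
  have 3: "(\<Sum>i\<le>m. (z i - b * y i)\<^sup>2) = 1 - b\<^sup>2"
  proof -
    have "(\<Sum>i\<le>m. (z i - b * y i)\<^sup>2)
        = (\<Sum>i\<le>m. (z i)\<^sup>2 - (2 * b) * (y i * z i) + b\<^sup>2 * (y i)\<^sup>2)"
      by (intro sum.cong) (auto simp: algebra_simps power2_eq_square)
    also have "\<dots> = 1 - 2 * b * b + b\<^sup>2 * 1"
      by (simp only: sum.distrib sum_subtractf sum_distrib_left[symmetric] nz ny b_def[symmetric])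
    finally show ?thesis by (simp add: power2_eq_square)
  qed
  have "(c - a * b)\<^sup>2 \<le> (1 - a\<^sup>2) * (1 - b\<^sup>2)"
    using Cauchy_Schwarz_ineq_sum[of "\<lambda>i. x i - a * y i" "\<lambda>i. z i - b * y i" "{..m}"]
    unfolding 1 2 3 .
  then have "\<bar>c - a * b\<bar> \<le> sqrt (1 - a\<^sup>2) * sqrt (1 - b\<^sup>2)"
    using real_sqrt_le_mono by (fastforce simp flip: real_sqrt_mult)
  then have "a * b - sqrt (1 - a\<^sup>2) * sqrt (1 - b\<^sup>2) \<le> c"
    by linarith
  then have le: "cos (arccos a + arccos b) \<le> c"
    using ab by (simp add: cos_add sin_arccos_abs abs_le_iff)
  have "arccos c \<le> arccos a + arccos b"
  proof (cases "arccos a + arccos b \<le> pi")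
    case True
    have "arccos c \<le> arccos (cos (arccos a + arccos b))"
      using le ab by (intro arccos_le_arccos) auto
    also have "\<dots> = arccos a + arccos b"
      using True ab by (intro arccos_cos) (auto simp: arccos_lbound)
    finally show ?thesis .
  next
    case False
    with arccos_ubound[of c] ab show ?thesis by linarith
  qed
  with x y z show ?thesis
    by (simp add: geodesic_dist_def a_def b_def c_def)
qed

lemma Metric_space_nsphere: "Metric_space (topspace (nsphere m)) (geodesic_dist m)"
proof
  show "0 \<le> geodesic_dist m x y" for x y
    using nsphere_inner_bounds[of x m y] by (simp add: geodesic_dist_def arccos_lbound)
  show "geodesic_dist m x y = geodesic_dist m y x" for x y
    by (auto simp: geodesic_dist_def mult.commute)
  show "geodesic_dist m x z \<le> geodesic_dist m x y + geodesic_dist m y z"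
    if "x \<in> topspace (nsphere m)" "y \<in> topspace (nsphere m)" "z \<in> topspace (nsphere m)" for x y z
    using that by (rule geodesic_triangle)
  show "geodesic_dist m x y = 0 \<longleftrightarrow> x = y"
    if x: "x \<in> topspace (nsphere m)" and y: "y \<in> topspace (nsphere m)" for x y
  proof
    assume "geodesic_dist m x y = 0"
    then have "arccos (\<Sum>i\<le>m. x i * y i) = 0"
      using x y by (simp add: geodesic_dist_def)
    then have 1: "(\<Sum>i\<le>m. x i * y i) = 1"
      using cos_arccos[OF nsphere_inner_bounds[OF x y]] by simp
    have "(\<Sum>i\<le>m. (x i - y i)\<^sup>2) = (\<Sum>i\<le>m. (x i)\<^sup>2 - 2 * (x i * y i) + (y i)\<^sup>2)"
      by (intro sum.cong) (auto simp: algebra_simps power2_eq_square)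
    also have "\<dots> = 0"
      using x y 1 by (simp add: sum.distrib sum_subtractf mem_nsphere flip: sum_distrib_left)
    finally have "\<forall>i\<le>m. x i = y i"
      by (simp add: sum_nonneg_eq_0_iff)
    with x y show "x = y"
      by (metis ext linorder_not_le mem_nsphere)
  next
    assume "x = y"
    with x show "geodesic_dist m x y = 0"
      by (simp add: geodesic_dist_def mem_nsphere flip: power2_eq_square)
  qed
qed

lemma mspace_round_sphere [simp]: "mspace (round_sphere m) = topspace (nsphere m)"
  by (simp add: round_sphere_def Metric_space.mspace_metric Metric_space_nsphere)

lemma mdist_round_sphere [simp]: "mdist (round_sphere m) = geodesic_dist m"
  by (simp add: round_sphere_def Metric_space.mdist_metric Metric_space_nsphere)


section \<open>Gromov--Hausdorff distance\<close>

definition correspondence :: "'a set \<Rightarrow> 'b set \<Rightarrow> ('a \<times> 'b) set \<Rightarrow> bool" where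
  "correspondence M N R \<longleftrightarrow> R \<subseteq> M \<times> N \<and> fst ` R = M \<and> snd ` R = N"

definition distortion :: "'a metric \<Rightarrow> 'b metric \<Rightarrow> ('a \<times> 'b) set \<Rightarrow> ereal" where
  "distortion X Y R =
     (SUP ((x, y), (x', y')) \<in> R \<times> R. ereal \<bar>mdist X x x' - mdist Y y y'\<bar>)"

definition gh_dist :: "'a metric \<Rightarrow> 'b metric \<Rightarrow> ereal" where
  "gh_dist X Y = (INF R \<in> {R. correspondence (mspace X) (mspace Y) R}. distortion X Y R) / 2"


section \<open>Chromatic profiles of Borsuk graphs\<close>

definition proper_colouring :: "'a set \<Rightarrow> ('a \<Rightarrow> 'a \<Rightarrow> bool) \<Rightarrow> nat \<Rightarrow> ('a \<Rightarrow> nat) \<Rightarrow> bool" where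
  "proper_colouring V adj k c \<longleftrightarrow>
     c ` V \<subseteq> {..<k} \<and> (\<forall>x\<in>V. \<forall>y\<in>V. adj x y \<longrightarrow> c x \<noteq> c y)"

text \<open>The infimum of the empty set is \<open>\<infinity>\<close>, so graphs without a finite colouring get \<open>\<infinity>\<close>.\<close>

definition chromatic_number :: "'a set \<Rightarrow> ('a \<Rightarrow> 'a \<Rightarrow> bool) \<Rightarrow> enat" where
  "chromatic_number V adj = (INF k \<in> {k. \<exists>c. proper_colouring V adj k c}. enat k)"

definition borsuk_adj :: "'a metric \<Rightarrow> real \<Rightarrow> 'a \<Rightarrow> 'a \<Rightarrow> bool" where
  "borsuk_adj X s x y \<longleftrightarrow> x \<in> mspace X \<and> y \<in> mspace X \<and> x \<noteq> y \<and> s \<le> mdist X x y"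

definition borsuk_chi :: "'a metric \<Rightarrow> real \<Rightarrow> enat" where
  "borsuk_chi X s = chromatic_number (mspace X) (borsuk_adj X s)"

definition chi_interleaving_dist :: "'a metric \<Rightarrow> 'b metric \<Rightarrow> ereal" where
  "chi_interleaving_dist X Y =
     (INF \<delta> \<in> {\<delta>. 0 \<le> \<delta> \<and> (\<forall>u>\<delta>. borsuk_chi X u \<le> borsuk_chi Y (u - \<delta>) \<and>
                                    borsuk_chi Y u \<le> borsuk_chi X (u - \<delta>))}. ereal \<delta>)"


section \<open>Geometric realizations and Vietoris--Rips complexes\<close>

text \<open>
  A simplicial complex is given by its set of (nonempty, finite) simplices.  A point of its
  realization is the family of its barycentric coordinates.  A closed simplex has its Euclidean
  topology, which is induced from the product topology, and the realization carries the
  weak topology: a set is open iff it meets every closed simplex in a relatively open set.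
\<close>

definition closed_simplex :: "'a set \<Rightarrow> ('a \<Rightarrow> real) set" where
  "closed_simplex \<sigma> = {t. (\<forall>v. 0 \<le> t v) \<and> (\<forall>v. v \<notin> \<sigma> \<longrightarrow> t v = 0) \<and> (\<Sum>v\<in>\<sigma>. t v) = 1}"

definition realization_open :: "'a set set \<Rightarrow> ('a \<Rightarrow> real) set \<Rightarrow> bool" where
  "realization_open K U \<longleftrightarrow>
     U \<subseteq> (\<Union>\<sigma>\<in>K. closed_simplex \<sigma>) \<and>
     (\<forall>\<sigma>\<in>K. openin (subtopology (powertop_real UNIV) (closed_simplex \<sigma>)) (U \<inter> closed_simplex \<sigma>))"

definition geometric_realization :: "'a set set \<Rightarrow> ('a \<Rightarrow> real) topology" where
  "geometric_realization K = topology (realization_open K)"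

lemma istopology_realization_open: "istopology (realization_open K)"
  unfolding istopology_def
proof (intro conjI allI impI)
  fix S T assume S: "realization_open K S" and T: "realization_open K T"
  have "S \<inter> T \<inter> closed_simplex \<sigma> = (S \<inter> closed_simplex \<sigma>) \<inter> (T \<inter> closed_simplex \<sigma>)" for \<sigma>
    by blast
  with S T show "realization_open K (S \<inter> T)"
    unfolding realization_open_def by (auto intro: openin_Int)
next
  fix \<U> assume \<U>: "\<forall>U\<in>\<U>. realization_open K U"
  have eq: "\<Union>\<U> \<inter> closed_simplex \<sigma> = \<Union>((\<lambda>U. U \<inter> closed_simplex \<sigma>) ` \<U>)" for \<sigma>
    by blast
  show "realization_open K (\<Union>\<U>)"
    unfolding realization_open_def
  proof (intro conjI ballI)
    show "\<Union>\<U> \<subseteq> (\<Union>\<sigma>\<in>K. closed_simplex \<sigma>)"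
      using \<U> unfolding realization_open_def by blast
    fix \<sigma> assume "\<sigma> \<in> K"
    with \<U> show "openin (subtopology (powertop_real UNIV) (closed_simplex \<sigma>)) (\<Union>\<U> \<inter> closed_simplex \<sigma>)"
      unfolding eq realization_open_def by (intro openin_Union) blast
  qed
qed

lemma openin_geometric_realization: "openin (geometric_realization K) U \<longleftrightarrow> realization_open K U"
  by (simp add: geometric_realization_def istopology_realization_open topology_inverse')

lemma topspace_geometric_realization:
  "topspace (geometric_realization K) = (\<Union>\<sigma>\<in>K. closed_simplex \<sigma>)"
proof
  show "topspace (geometric_realization K) \<subseteq> (\<Union>\<sigma>\<in>K. closed_simplex \<sigma>)"
    using openin_topspace[of "geometric_realization K"]
    unfolding openin_geometric_realization realization_open_def by blast
  have "(\<Union>\<sigma>'\<in>K. closed_simplex \<sigma>') \<inter> closed_simplex \<sigma> = closed_simplex \<sigma>" if "\<sigma> \<in> K" for \<sigma>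
    using that by blast
  then have "realization_open K (\<Union>\<sigma>\<in>K. closed_simplex \<sigma>)"
    unfolding realization_open_def using openin_subtopology_refl by force
  then show "(\<Union>\<sigma>\<in>K. closed_simplex \<sigma>) \<subseteq> topspace (geometric_realization K)"
    by (simp add: openin_subset flip: openin_geometric_realization)
qed

definition vr_complex :: "'a metric \<Rightarrow> real \<Rightarrow> 'a set set" where
  "vr_complex X r =
     {\<sigma>. finite \<sigma> \<and> \<sigma> \<noteq> {} \<and> \<sigma> \<subseteq> mspace X \<and> (\<forall>x\<in>\<sigma>. \<forall>y\<in>\<sigma>. mdist X x y \<le> r)}"

definition vietoris_rips :: "'a metric \<Rightarrow> real \<Rightarrow> ('a \<Rightarrow> real) topology" where
  "vietoris_rips X r = geometric_realization (vr_complex X r)"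

text \<open>
  The simplicial extension of a bijection \<open>g\<close> of the vertices sends the point with coordinates
  \<open>t\<close> to the one with coordinates \<open>t \<circ> inv g\<close>, and the antipode is its own inverse.
\<close>

definition vr_antipode :: "((nat \<Rightarrow> real) \<Rightarrow> real) \<Rightarrow> ((nat \<Rightarrow> real) \<Rightarrow> real)" where
  "vr_antipode t = t \<circ> antipode"


section \<open>Coindex\<close>

text \<open>
  A space with an action of the group of order two is a topology with an involution of its
  points.  The supremum may be \<open>\<infinity>\<close>; it is over a nonempty set whenever the space is nonempty.
\<close>

definition odd_map :: "nat \<Rightarrow> 'a topology \<Rightarrow> ('a \<Rightarrow> 'a) \<Rightarrow> ((nat \<Rightarrow> real) \<Rightarrow> 'a) \<Rightarrow> bool" where
  "odd_map k X \<tau> f \<longleftrightarrow>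
     continuous_map (nsphere k) X f \<and> (\<forall>x\<in>topspace (nsphere k). f (antipode x) = \<tau> (f x))"

definition coindex :: "'a topology \<Rightarrow> ('a \<Rightarrow> 'a) \<Rightarrow> enat" where
  "coindex X \<tau> = (SUP k \<in> {k. \<exists>f. odd_map k X \<tau> f}. enat k)"

definition coindex_threshold :: "nat \<Rightarrow> nat \<Rightarrow> ereal" where
  "coindex_threshold m n =
     (INF r \<in> {r. 0 \<le> r \<and> enat n \<le> coindex (vietoris_rips (round_sphere m) r) vr_antipode}. ereal r)"

end

theory Submission
  imports Defs
begin

text \<open>
  A correspondence of distortion \<open>\<delta>\<close> contains the graphs of maps in both directions
  that change distances by at most \<open>\<delta>\<close>.  Such a map is a homomorphism from the Borsuk graph
  at scale \<open>u > \<delta>\<close> to that at scale \<open>u - \<delta>\<close>, so \<open>\<delta>\<close> is admissible in the definition of the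
  interleaving distance (\<open>chi_interleaving_dist_le_gh_dist\<close>).

  The bound on the interleaving distance is a volume argument.  If
  \<open>\<delta> < 289 pi / 400\<close> were admissible, the Borsuk graph of the 30000-sphere at scale
  \<open>u = 3 pi / 4\<close> would need at most as many colours as that of the 239-sphere at the scale
  \<open>s = u - \<delta> > 11 pi / 400\<close>.  At scale \<open>s\<close> the 239-sphere has a colouring by the cells of a cubic
  grid of mesh \<open>1 / 180\<close>, with at most \<open>361^240\<close> colours.  On the 30000-sphere, on the other
  hand, a set \<open>A\<close> without two points at distance at least \<open>u\<close> is far from \<open>- A\<close>,
  and concentration of measure forces it to be small: its proportion is about
  \<open>sin (u / 2) ^ 30001\<close> at most.  This is the Brunn--Minkowski proof of the
  isodiametric inequality, applied to Gaussian weights on the cone over \<open>A\<close>.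
  Colour classes need not be measurable, and therefore the cone is sampled on a fine
  lattice: a discrete Prekopa--Leindler inequality
  (\<open>discrete_prekopa_leindler\<close>) plays the part of Brunn--Minkowski and all sums are finite.
  The two estimates contradict each other since \<open>1.05^125 > 362\<close> and
  \<open>30000 = 125 * 240\<close> (\<open>borsuk_chi_sphere_239_le\<close>, \<open>borsuk_chi_sphere_30000_gt\<close>).

  The coindex threshold is small for a different reason: the 240-dimensional space
  has room for 30001 lines that are nearly orthogonal.  If all inner products of distinct unit
  vectors among \<open>v 0, \<dots>, v n\<close> have modulus at most \<open>\<kappa>\<close>, then the boundary of the
  cross-polytope with vertices \<open>\<plusminus> v i\<close>, an \<open>n\<close>-sphere, is an antipodally invariant subcomplex
  of the Vietoris--Rips complex at scale \<open>arccos (- \<kappa>)\<close> (\<open>coindex_vietoris_rips_ge\<close>).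
  A Reed--Solomon code, the graphs of the polynomials of degree at most 4 over the field with 13
  elements, provides such vectors with \<open>\<kappa> = 4 / 13 < 1 / 2\<close>
  (\<open>reed_solomon_directions\<close>).
\<close>

section \<open>Correspondences and graph homomorphisms\<close>

text \<open>
  The hypothesis \<open>\<delta> < u\<close> makes the images of adjacent points distinct: they are at positive
  distance \<open>u - \<delta>\<close> or more.
\<close>
lemma borsuk_chi_le_of_map:
  assumes q: "\<And>x. x \<in> mspace V \<Longrightarrow> q x \<in> mspace W"
    and d: "\<And>x y. \<lbrakk>x \<in> mspace V; y \<in> mspace V\<rbrakk> \<Longrightarrow> \<bar>mdist V x y - mdist W (q x) (q y)\<bar> \<le> \<delta>"
    and u: "\<delta> < u"
  shows "borsuk_chi V u \<le> borsuk_chi W (u - \<delta>)"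
  unfolding borsuk_chi_def chromatic_number_def
proof (intro INF_superset_mono order_refl subsetI CollectI)
  fix k assume "k \<in> {k. \<exists>c. proper_colouring (mspace W) (borsuk_adj W (u - \<delta>)) k c}"
  then obtain c where c: "proper_colouring (mspace W) (borsuk_adj W (u - \<delta>)) k c" by blast
  have "borsuk_adj W (u - \<delta>) (q x) (q y)" if "borsuk_adj V u x y" for x y
  proof -
    have x: "x \<in> mspace V" "y \<in> mspace V" "u \<le> mdist V x y"
      using that by (auto simp: borsuk_adj_def)
    have "u - \<delta> \<le> mdist W (q x) (q y)" using d[OF x(1,2)] x(3) by linarith
    moreover from this have "q x \<noteq> q y" using u mdist_zero[OF q[OF x(1)] q[OF x(1)]] by auto
    ultimately show ?thesis using q x by (auto simp: borsuk_adj_def)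
  qed
  then have "proper_colouring (mspace V) (borsuk_adj V u) k (c \<circ> q)"
    using c q unfolding proper_colouring_def by fastforce
  then show "\<exists>c. proper_colouring (mspace V) (borsuk_adj V u) k c" by blast
qed

lemma chi_interleaving_dist_le_distortion:
  assumes R: "correspondence (mspace X) (mspace Y) R" and ne: "mspace X \<noteq> {}"
  shows "chi_interleaving_dist X Y \<le> distortion X Y R"
proof -
  have dR: "ereal \<bar>mdist X x x' - mdist Y y y'\<bar> \<le> distortion X Y R"
    if "(x, y) \<in> R" "(x', y') \<in> R" for x y x' y'
    unfolding distortion_def using that by (intro SUP_upper2[of "((x, y), (x', y'))"]) auto
  obtain x0 y0 where xy0: "(x0, y0) \<in> R" "x0 \<in> mspace X" "y0 \<in> mspace Y"
    using R ne by (force simp: correspondence_def)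
  have "0 \<le> ereal \<bar>mdist X x0 x0 - mdist Y y0 y0\<bar>" by simp
  also have "\<dots> \<le> distortion X Y R" using dR xy0 by blast
  finally have nonneg: "0 \<le> distortion X Y R" .
  show ?thesis
  proof (cases "distortion X Y R")
    case (real \<delta>)
    obtain p where p: "\<And>x. x \<in> mspace X \<Longrightarrow> (x, p x) \<in> R"
    proof -
      have "\<forall>x\<in>mspace X. \<exists>y. (x, y) \<in> R" using R by (force simp: correspondence_def)
      then show ?thesis using that by metis
    qed
    obtain q where q: "\<And>y. y \<in> mspace Y \<Longrightarrow> (q y, y) \<in> R"
    proof -
      have "\<forall>y\<in>mspace Y. \<exists>x. (x, y) \<in> R" using R by (force simp: correspondence_def)
      then show ?thesis using that by metis
    qed
    have sub: "R \<subseteq> mspace X \<times> mspace Y" using R by (simp add: correspondence_def)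
    have "borsuk_chi X u \<le> borsuk_chi Y (u - \<delta>)" if "u > \<delta>" for u
    proof (rule borsuk_chi_le_of_map[where q = p])
      show "p x \<in> mspace Y" if "x \<in> mspace X" for x using p[OF that] sub by auto
      show "\<bar>mdist X x y - mdist Y (p x) (p y)\<bar> \<le> \<delta>" if "x \<in> mspace X" "y \<in> mspace X" for x y
        using dR[OF p[OF that(1)] p[OF that(2)]] real by simp
    qed fact
    moreover have "borsuk_chi Y u \<le> borsuk_chi X (u - \<delta>)" if "u > \<delta>" for u
    proof (rule borsuk_chi_le_of_map[where q = q])
      show "q y \<in> mspace X" if "y \<in> mspace Y" for y using q[OF that] sub by auto
      show "\<bar>mdist Y x y - mdist X (q x) (q y)\<bar> \<le> \<delta>" if "x \<in> mspace Y" "y \<in> mspace Y" for x y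
        using dR[OF q[OF that(1)] q[OF that(2)]] real by (simp add: abs_minus_commute)
    qed fact
    ultimately show ?thesis
      unfolding real chi_interleaving_dist_def using nonneg real by (intro INF_lower) auto
  qed (use nonneg in auto)
qed

lemma chi_interleaving_dist_le_gh_dist:
  assumes "mspace X \<noteq> {}"
  shows "chi_interleaving_dist X Y / 2 \<le> gh_dist X Y"
  unfolding gh_dist_def
  by (intro ereal_divide_right_mono INF_greatest chi_interleaving_dist_le_distortion)
     (use assms in auto)

section \<open>Few colours on the small sphere\<close>
lemma chromatic_number_le_card:
  assumes fin: "finite D" and F: "F ` V \<subseteq> D"
    and sep: "\<And>x y. \<lbrakk>x \<in> V; y \<in> V; F x = F y\<rbrakk> \<Longrightarrow> \<not> adj x y"
  shows "chromatic_number V adj \<le> enat (card D)"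
proof -
  obtain e where e: "bij_betw e D {0..<card D}"
    using ex_bij_betw_finite_nat[OF fin] by blast
  have "proper_colouring V adj (card D) (e \<circ> F)"
    unfolding proper_colouring_def
  proof (intro conjI ballI impI)
    show "(e \<circ> F) ` V \<subseteq> {..<card D}"
      using F bij_betw_imp_surj_on[OF e] by fastforce
    fix x y assume xy: "x \<in> V" "y \<in> V" "adj x y"
    then have "F x \<noteq> F y" using sep by blast
    moreover have "F x \<in> D" "F y \<in> D" using F xy by auto
    ultimately show "(e \<circ> F) x \<noteq> (e \<circ> F) y"
      using bij_betw_imp_inj_on[OF e] by (auto dest: inj_onD)
  qed
  then show ?thesis
    unfolding chromatic_number_def by (intro INF_lower) blast
qed

lemma chromatic_number_le_D:
  assumes "chromatic_number V adj \<le> enat K"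
  obtains k c where "k \<le> K" "proper_colouring V adj k c"
proof -
  let ?S = "{k. \<exists>c. proper_colouring V adj k c}"
  have "?S \<noteq> {}"
  proof
    assume e: "?S = {}"
    show False using assms unfolding chromatic_number_def e by (simp add: top_enat_def)
  qed
  then have "(INF k\<in>?S. enat k) \<in> enat ` ?S"
    by (intro wellorder_InfI[of "enat (SOME k. k \<in> ?S)"]) (metis image_eqI some_in_eq)
  then show ?thesis
    using assms that unfolding chromatic_number_def[symmetric] by fastforce
qed

lemma cos_upper_quartic: "cos x \<le> 1 - x\<^sup>2 / 2 + x ^ 4 / 24" for x :: real
proof -
  obtain t where t: "cos x = (\<Sum>m<4. cos_coeff m * x ^ m) + cos (t + 1 / 2 * real 4 * pi) / fact 4 * x ^ 4"
    using Maclaurin_cos_expansion[of x 4] by blast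
  have "(\<Sum>m<4. cos_coeff m * x ^ m) = 1 - x\<^sup>2 / 2"
    by (simp add: lessThan_nat_numeral lessThan_Suc cos_coeff_def)
  moreover have "cos (t + 1 / 2 * real 4 * pi) / fact 4 * x ^ 4 \<le> 1 / fact 4 * x ^ 4"
    by (intro mult_right_mono divide_right_mono) auto
  ultimately show ?thesis using t by (simp add: fact_numeral)
qed

text \<open>
  The colour of a point is the cell containing it in the cubic grid of mesh \<open>1 / q\<close>.
  Two points in a common cell have squared chordal distance \<open>2 - 2 cos \<theta>\<close> at most
  \<open>(m + 1) / q\<^sup>2\<close>, which bounds their geodesic distance \<open>\<theta>\<close>.
\<close>
lemma borsuk_chi_sphere_le_grid:
  fixes m q :: nat
  assumes q: "0 < q" and s: "arccos (1 - real (Suc m) / (2 * (real q)\<^sup>2)) < s"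
    and small: "real (Suc m) \<le> 4 * (real q)\<^sup>2"
  shows "borsuk_chi (round_sphere m) s \<le> enat ((2 * q + 1) ^ Suc m)"
proof -
  let ?D = "PiE {..m} (\<lambda>_. {- int q..int q})"
  let ?F = "\<lambda>x::nat \<Rightarrow> real. restrict (\<lambda>i. \<lfloor>q * x i\<rfloor>) {..m}"
  have "card {- int q..int q} = 2 * q + 1" by simp
  then have card: "card ?D = (2 * q + 1) ^ Suc m"
    by (simp only: card_PiE[OF finite_atMost] prod_constant card_atMost)
  have "chromatic_number (mspace (round_sphere m)) (borsuk_adj (round_sphere m) s) \<le> enat (card ?D)"
  proof (rule chromatic_number_le_card[where F = ?F])
    show "finite ?D" by (intro finite_PiE) auto
    show "?F ` mspace (round_sphere m) \<subseteq> ?D"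
    proof (intro image_subsetI PiE_I)
      fix x i assume x: "x \<in> mspace (round_sphere m)" and i: "i \<in> {..m}"
      have "(x i)\<^sup>2 \<le> (\<Sum>i\<le>m. (x i)\<^sup>2)" using i by (intro member_le_sum) auto
      also have "\<dots> = 1" using x by (simp add: mem_nsphere)
      finally have "\<bar>x i\<bar> \<le> 1" by (simp add: abs_square_le_1)
      then have "\<bar>q * x i\<bar> \<le> real q * 1" unfolding abs_mult by (intro mult_mono) auto
      then have "- int q \<le> \<lfloor>q * x i\<rfloor>" "\<lfloor>q * x i\<rfloor> \<le> int q" by linarith+
      then show "?F x i \<in> {- int q..int q}" using i by simp
    qed auto
    fix x y assume "x \<in> mspace (round_sphere m)" "y \<in> mspace (round_sphere m)"
      and F: "?F x = ?F y"
    then have xy: "x \<in> topspace (nsphere m)" "y \<in> topspace (nsphere m)" by auto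
    have "(x i - y i)\<^sup>2 \<le> 1 / (real q)\<^sup>2" if i: "i \<le> m" for i
    proof -
      have "\<lfloor>q * x i\<rfloor> = \<lfloor>q * y i\<rfloor>"
        using fun_cong[OF F, of i] i by simp
      then have "\<bar>q * x i - q * y i\<bar> \<le> 1" by linarith
      then have "(q * x i - q * y i)\<^sup>2 \<le> 1" by (simp add: abs_square_le_1)
      then have "(real q)\<^sup>2 * (x i - y i)\<^sup>2 \<le> 1"
        by (simp flip: power_mult_distrib right_diff_distrib)
      then show ?thesis using q by (simp add: field_simps)
    qed
    then have "(\<Sum>i\<le>m. (x i - y i)\<^sup>2) \<le> (\<Sum>i\<le>m. 1 / (real q)\<^sup>2)" by (intro sum_mono) auto
    moreover have "(\<Sum>i\<le>m. (x i - y i)\<^sup>2) = 2 - 2 * (\<Sum>i\<le>m. x i * y i)"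
    proof -
      have "(\<Sum>i\<le>m. (x i - y i)\<^sup>2) = (\<Sum>i\<le>m. (x i)\<^sup>2 + (y i)\<^sup>2 - 2 * (x i * y i))"
        by (intro sum.cong) (auto simp: power2_eq_square algebra_simps)
      also have "\<dots> = 2 - 2 * (\<Sum>i\<le>m. x i * y i)"
        unfolding sum_subtractf sum.distrib sum_distrib_left[symmetric] using xy by (simp add: mem_nsphere)
      finally show ?thesis .
    qed
    ultimately have "1 - real (Suc m) / (2 * (real q)\<^sup>2) \<le> (\<Sum>i\<le>m. x i * y i)"
      by (simp add: field_simps)
    then have "arccos (\<Sum>i\<le>m. x i * y i) \<le> arccos (1 - real (Suc m) / (2 * (real q)\<^sup>2))"
      using nsphere_inner_bounds[OF xy] small q by (intro arccos_le_arccos) (auto simp: field_simps)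
    then show "\<not> borsuk_adj (round_sphere m) s x y"
      using s xy by (simp add: borsuk_adj_def geodesic_dist_def)
  qed
  then show ?thesis unfolding borsuk_chi_def card .
qed

lemma borsuk_chi_sphere_239_le:
  assumes s: "11 * pi / 400 < s"
  shows "borsuk_chi (round_sphere 239) s \<le> enat (361 ^ 240)"
proof -
  \<comment> \<open>slightly less than \<open>11 * pi / 400\<close>, and still large enough for \<open>cos z \<le> 1 - 240 / (2 * 180\<^sup>2)\<close>\<close>
  define z where "z = (863 / 10000 :: real)"
  have "z \<le> 11 * pi / 400" using pi_approx by (simp add: z_def)
  then have "cos (11 * pi / 400) \<le> cos z"
    by (intro cos_monotone_0_pi_le) (auto simp: z_def)
  also have "\<dots> \<le> 1 - z\<^sup>2 / 2 + z ^ 4 / 24" by (rule cos_upper_quartic)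
  also have "\<dots> \<le> 1 - 1 / 270" by (simp add: z_def eval_nat_numeral)
  finally have "arccos (1 - 1 / 270) \<le> arccos (cos (11 * pi / 400))"
    by (intro arccos_le_arccos) auto
  also have "\<dots> = 11 * pi / 400" by (intro arccos_cos) auto
  finally have a: "arccos (1 - 1 / 270) < s" using s by simp
  have n: "2 * 180 + 1 = (361::nat)" "Suc 239 = 240"
    and r: "1 - real 240 / (2 * (real 180)\<^sup>2) = 1 - 1 / 270" by simp_all
  show ?thesis
    by (rule borsuk_chi_sphere_le_grid[of 180 239 s, unfolded n r, OF _ a]) simp_all
qed

section \<open>A discrete Prekopa--Leindler inequality\<close>

text \<open>
  The translates \<open>A - max B\<close> and \<open>max A - B\<close> lie on the two sides of
  \<open>max A - max B\<close> and have only that point in common.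
\<close>
lemma card_difference_set:
  fixes A B :: "int set"
  assumes "finite A" "finite B" "A \<noteq> {}" "B \<noteq> {}"
    and D: "finite D" "\<And>a b. \<lbrakk>a \<in> A; b \<in> B\<rbrakk> \<Longrightarrow> a - b \<in> D"
  shows "card A + card B \<le> card D + 1"
proof -
  let ?L = "(\<lambda>a. a - Max B) ` A" and ?R = "(\<lambda>b. Max A - b) ` B"
  have "?L \<inter> ?R \<subseteq> {Max A - Max B}"
  proof
    fix d assume "d \<in> ?L \<inter> ?R"
    then obtain a b where ab: "a \<in> A" "b \<in> B" "d = a - Max B" "d = Max A - b" by blast
    moreover have "a \<le> Max A" "b \<le> Max B" using assms ab by auto
    ultimately show "d \<in> {Max A - Max B}" by simp
  qed
  then have "card (?L \<inter> ?R) \<le> 1" by (metis card.empty card_insert_disjoint card_mono equals0D finite.emptyI finite.insertI One_nat_def)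
  moreover have "card (?L \<union> ?R) + card (?L \<inter> ?R) = card ?L + card ?R"
    using assms by (intro card_Un_Int[symmetric]) auto
  moreover have "card ?L = card A" "card ?R = card B" by (auto intro!: card_image inj_onI)
  moreover have "Max A \<in> A" "Max B \<in> B" using assms by (auto intro: Max_in)
  then have "card (?L \<union> ?R) \<le> card D"
    using D by (intro card_mono) auto
  ultimately show ?thesis by linarith
qed

lemma layer_cake:
  fixes v :: real
  assumes "0 \<le> v"
  shows "((\<lambda>t. if t < v then 1 else 0) has_integral (min v 1)) {0..1}"
proof -
  have "((\<lambda>t. 1::real) has_integral (min v 1)) {0..min v 1}"
    using has_integral_const_real[of "1::real" 0 "min v 1"] assms by simp
  then have "((\<lambda>t. if t \<in> {0..min v 1} then 1::real else 0) has_integral (min v 1)) {0..1}"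
    by (subst has_integral_restrict) auto
  then show ?thesis
    by (rule has_integral_spike_finite[where S = "{min v 1}", rotated 2]) auto
qed

text \<open>
  The proof of the Prekopa--Leindler inequality on the real line: normalise \<open>f\<close> and \<open>g\<close> to have
  maximum 1, compare the superlevel sets at each height with the Brunn--Minkowski inequality for
  sets, and integrate over the height.  On the integers the inequality for sets loses 1, which
  after undoing the normalisation becomes the summand \<open>M\<close>.  The function \<open>h\<close> lives on
  differences, which is the usual formulation with sums after reflecting \<open>g\<close>; it corresponds to
  half-integral midpoints, whence the factor 4.
\<close>
lemma discrete_prekopa_leindler_line:
  fixes f g h :: "int \<Rightarrow> real"
  assumes S: "finite S" and D: "finite D" "\<And>x y. \<lbrakk>x \<in> S; y \<in> S\<rbrakk> \<Longrightarrow> x - y \<in> D"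
    and f: "\<And>x. x \<in> S \<Longrightarrow> 0 \<le> f x" and g: "\<And>x. x \<in> S \<Longrightarrow> 0 \<le> g x"
    and h: "\<And>d. d \<in> D \<Longrightarrow> 0 \<le> h d" "\<And>d. d \<in> D \<Longrightarrow> h d \<le> M"
    and fgh: "\<And>x y. \<lbrakk>x \<in> S; y \<in> S\<rbrakk> \<Longrightarrow> f x * g y \<le> (h (x - y))\<^sup>2"
  shows "4 * (sum f S * sum g S) \<le> (sum h D + M)\<^sup>2"
proof (cases "(\<forall>x\<in>S. f x = 0) \<or> (\<forall>x\<in>S. g x = 0)")
  case True
  then have "sum f S * sum g S = 0" by auto
  then show ?thesis by (simp only: mult_zero_right zero_le_power2)
next
  case False
  then obtain x1 y1 where 1: "x1 \<in> S" "f x1 \<noteq> 0" "y1 \<in> S" "g y1 \<noteq> 0" by blast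
  have neS: "S \<noteq> {}" using 1 by auto
  define a where "a = Max (f ` S)"
  define b where "b = Max (g ` S)"
  have "a \<in> f ` S" "b \<in> g ` S" unfolding a_def b_def using S neS by (auto intro!: Max_in)
  then obtain x0 y0 where xy0: "x0 \<in> S" "a = f x0" "y0 \<in> S" "b = g y0" by auto
  have fa: "f x \<le> a" and gb: "g x \<le> b" if "x \<in> S" for x
    unfolding a_def b_def using that S by auto
  have a0: "0 < a" using fa[of x1] f[of x1] 1 by linarith
  have b0: "0 < b" using gb[of y1] g[of y1] 1 by linarith
  define c where "c = sqrt (a * b)"
  have c0: "0 < c" and c2: "c\<^sup>2 = a * b" using a0 b0 by (auto simp: c_def)
  have d0: "x0 - y0 \<in> D" using D(2) xy0(1,3) .
  have "c\<^sup>2 \<le> (h (x0 - y0))\<^sup>2" unfolding c2 xy0(2,4) using fgh xy0(1,3) .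
  then have "c \<le> h (x0 - y0)" using h(1)[OF d0] by (rule power2_le_imp_le)
  then have cM: "c \<le> M" using h(2)[OF d0] by linarith
  \<comment> \<open>the heights \<open>t\<close> run through the unit interval, with \<open>f / a\<close>, \<open>g / b\<close> and \<open>h / c\<close> normalised\<close>
  let ?l = "\<lambda>v t::real. if t < v then 1 else 0 :: real"
  have "((\<lambda>t. (\<Sum>x\<in>S. ?l (f x / a) t) + (\<Sum>y\<in>S. ?l (g y / b) t) - 1) has_integral
      (\<Sum>x\<in>S. min (f x / a) 1) + (\<Sum>y\<in>S. min (g y / b) 1) - 1) {0..1}"
    using S f g a0 b0 has_integral_const_real[of "1::real" 0 1]
    by (intro has_integral_diff has_integral_add has_integral_sum layer_cake) auto
  moreover have "((\<lambda>t. \<Sum>d\<in>D. ?l (h d / c) t) has_integral (\<Sum>d\<in>D. min (h d / c) 1)) {0..1}"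
    using D h c0 by (intro has_integral_sum layer_cake) auto
  moreover have "(\<Sum>x\<in>S. ?l (f x / a) t) + (\<Sum>y\<in>S. ?l (g y / b) t) - 1 \<le> (\<Sum>d\<in>D. ?l (h d / c) t)"
    if t: "t \<in> {0..1}" for t
  proof -
    let ?A = "{x\<in>S. t < f x / a}" and ?B = "{y\<in>S. t < g y / b}" and ?E = "{d\<in>D. t < h d / c}"
    have e: "(\<Sum>x\<in>X. ?l (w x) t) = card {x\<in>X. t < w x}" if "finite X" for X :: "int set" and w
      using that by (simp add: sum.If_cases Int_def)
    have "card ?A + card ?B \<le> card ?E + 1"
    proof (cases "t < 1")
      case True
      show ?thesis
      proof (rule card_difference_set)
        show "?A \<noteq> {}" using True xy0 a0 by force
        show "?B \<noteq> {}" using True xy0 b0 by force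
        fix x y assume x: "x \<in> ?A" and y: "y \<in> ?B"
        have "t * a * (t * b) < f x * g y"
          using x y a0 b0 t by (intro mult_strict_mono') (auto simp: pos_less_divide_eq)
        also have "\<dots> \<le> (h (x - y))\<^sup>2" using fgh x y by auto
        also have "t * a * (t * b) = (t * c)\<^sup>2"
          unfolding power_mult_distrib c2 by (simp add: power2_eq_square mult_ac)
        finally have "(t * c)\<^sup>2 < (h (x - y))\<^sup>2" .
        moreover have d: "x - y \<in> D" using D(2) x y by blast
        ultimately have "t * c < h (x - y)" using h(1) by (blast intro: power_less_imp_less_base)
        then show "x - y \<in> ?E" using c0 d by (simp add: pos_less_divide_eq)
      qed (use S D in auto)
    next
      case False
      moreover have "f x / a \<le> 1" "g x / b \<le> 1" if "x \<in> S" for x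
        using fa[OF that] gb[OF that] a0 b0 by auto
      ultimately have "?A = {}" "?B = {}" by force+
      then show ?thesis by (simp only: card.empty)
    qed
    then show ?thesis unfolding e[OF S] e[OF D(1)] by linarith
  qed
  ultimately have "(\<Sum>x\<in>S. min (f x / a) 1) + (\<Sum>y\<in>S. min (g y / b) 1) - 1 \<le> (\<Sum>d\<in>D. min (h d / c) 1)"
    by (rule has_integral_le)
  also have "\<dots> \<le> (\<Sum>d\<in>D. h d / c)" by (intro sum_mono) auto
  also have "\<dots> = sum h D / c" by (simp add: sum_divide_distrib)
  also have "(\<Sum>x\<in>S. min (f x / a) 1) = sum f S / a"
    unfolding sum_divide_distrib using fa a0 by (intro sum.cong) auto
  also have "(\<Sum>y\<in>S. min (g y / b) 1) = sum g S / b"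
    unfolding sum_divide_distrib using gb b0 by (intro sum.cong) auto
  finally have le: "c * (sum f S / a + sum g S / b) \<le> sum h D + c"
    using c0 by (simp add: field_simps)
  have nn: "0 \<le> sum f S / a + sum g S / b" using f g a0 b0 by (intro add_nonneg_nonneg divide_nonneg_pos sum_nonneg) auto
  \<comment> \<open>the inequality of arithmetic and geometric means turns the additive bound into a product\<close>
  have "4 * (v * w) \<le> (v + w)\<^sup>2" for v w :: real
    using zero_le_power2[of "v - w"] by (simp add: power2_eq_square algebra_simps)
  then have "4 * (sum f S / a * (sum g S / b)) \<le> (sum f S / a + sum g S / b)\<^sup>2" .
  then have "a * b * (4 * (sum f S / a * (sum g S / b))) \<le> c\<^sup>2 * (sum f S / a + sum g S / b)\<^sup>2"
    unfolding c2 using a0 b0 by (intro mult_left_mono) auto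
  then have "4 * (sum f S * sum g S) \<le> (c * (sum f S / a + sum g S / b))\<^sup>2"
    using a0 b0 by (simp add: power_mult_distrib)
  also have "\<dots> \<le> (sum h D + M)\<^sup>2"
    using le cM nn c0 by (intro power_mono) auto
  finally show ?thesis .
qed

lemma sum_PiE_lessThan_Suc:
  "(\<Sum>x\<in>PiE {..<Suc n} (\<lambda>_. S). f x) = (\<Sum>a\<in>S. \<Sum>x\<in>PiE {..<n} (\<lambda>_. S). f (x(n := a)))"
proof -
  have "(\<Sum>x\<in>PiE {..<Suc n} (\<lambda>_. S). f x)
      = sum f ((\<lambda>(y, g). g(n := y)) ` (S \<times> PiE {..<n} (\<lambda>_. S)))"
    by (simp add: lessThan_Suc PiE_insert_eq)
  also have "\<dots> = (\<Sum>(a, x)\<in>S \<times> PiE {..<n} (\<lambda>_. S). f (x(n := a)))"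
    by (subst sum.reindex[OF inj_combinator]) (auto simp: case_prod_unfold)
  finally show ?thesis by (simp add: sum.cartesian_product)
qed

text \<open>
  Tensorisation: summing out the first \<open>n\<close> coordinates with the last ones fixed at \<open>a\<close> and
  \<open>b\<close> produces functions of \<open>a\<close> and \<open>b\<close> that satisfy the hypothesis on the line.  The slices
  of \<open>f\<close> at \<open>a\<close> and of \<open>g\<close> at \<open>b\<close> differ even if \<open>f = g\<close>, and they bring in the factor
  \<open>(\<eta> (a - b))\<^sup>2\<close>; for the induction both \<open>g\<close> and the constant \<open>C\<close> have to be arbitrary.
\<close>
lemma discrete_prekopa_leindler:
  fixes f g :: "(nat \<Rightarrow> int) \<Rightarrow> real" and \<eta> :: "int \<Rightarrow> real"
  assumes S: "finite S" and D: "finite D" "\<And>x y. \<lbrakk>x \<in> S; y \<in> S\<rbrakk> \<Longrightarrow> x - y \<in> D"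
    and \<eta>: "\<And>d. d \<in> D \<Longrightarrow> 0 \<le> \<eta> d" "\<And>d. d \<in> D \<Longrightarrow> \<eta> d \<le> M" and "0 \<le> M" and "0 \<le> C"
    and "\<And>x. x \<in> PiE {..<n} (\<lambda>_. S) \<Longrightarrow> 0 \<le> f x"
    and "\<And>x. x \<in> PiE {..<n} (\<lambda>_. S) \<Longrightarrow> 0 \<le> g x"
    and "\<And>x y. \<lbrakk>x \<in> PiE {..<n} (\<lambda>_. S); y \<in> PiE {..<n} (\<lambda>_. S)\<rbrakk>
           \<Longrightarrow> f x * g y \<le> C * (\<Prod>i<n. \<eta> (x i - y i))\<^sup>2"
  shows "sum f (PiE {..<n} (\<lambda>_. S)) * sum g (PiE {..<n} (\<lambda>_. S)) \<le> C * (((sum \<eta> D + M) / 2) ^ n)\<^sup>2"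
  using assms(7-)
proof (induction n arbitrary: f g C)
  case 0
  then show ?case by (simp add: PiE_empty_domain)
next
  case (Suc n)
  let ?P = "PiE {..<n} (\<lambda>_. S)"
  define B where "B = (sum \<eta> D + M) / 2"
  have B0: "0 \<le> B" using \<eta> \<open>0 \<le> M\<close> by (simp add: B_def sum_nonneg)
  define F where "F a = (\<Sum>x\<in>?P. f (x(n := a)))" for a
  define G where "G a = (\<Sum>x\<in>?P. g (x(n := a)))" for a
  define K where "K = sqrt C * B ^ n"
  have K0: "0 \<le> K" and K2: "K\<^sup>2 = C * (B ^ n)\<^sup>2"
    using Suc.prems(1) B0 by (auto simp: K_def power_mult_distrib)
  have up: "x(n := a) \<in> PiE {..<Suc n} (\<lambda>_. S)" if "x \<in> ?P" "a \<in> S" for x a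
    using that by (auto simp: PiE_iff extensional_def less_Suc_eq)
  have FG: "F a * G b \<le> (K * \<eta> (a - b))\<^sup>2" if ab: "a \<in> S" "b \<in> S" for a b
  proof -
    have "F a * G b \<le> (C * (\<eta> (a - b))\<^sup>2) * (B ^ n)\<^sup>2"
      unfolding F_def G_def B_def
    proof (rule Suc.IH)
      show "0 \<le> C * (\<eta> (a - b))\<^sup>2" using Suc.prems(1) by simp
      show "0 \<le> f (x(n := a))" if "x \<in> ?P" for x
        using Suc.prems(2) up[OF that] ab by blast
      show "0 \<le> g (x(n := b))" if "x \<in> ?P" for x
        using Suc.prems(3) up[OF that] ab by blast
      fix x y assume x: "x \<in> ?P" and y: "y \<in> ?P"
      have "f (x(n := a)) * g (y(n := b)) \<le>
          C * (\<Prod>i<Suc n. \<eta> ((x(n := a)) i - (y(n := b)) i))\<^sup>2"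
        using Suc.prems(4) up x y ab by blast
      also have "(\<Prod>i<Suc n. \<eta> ((x(n := a)) i - (y(n := b)) i)) = (\<Prod>i<n. \<eta> (x i - y i)) * \<eta> (a - b)"
        by (simp add: lessThan_Suc mult.commute)
      finally show "f (x(n := a)) * g (y(n := b)) \<le> C * (\<eta> (a - b))\<^sup>2 * (\<Prod>i<n. \<eta> (x i - y i))\<^sup>2"
        by (simp add: power_mult_distrib mult_ac fun_upd_def)
    qed
    then show ?thesis by (simp add: power_mult_distrib K2 mult_ac)
  qed
  have "4 * (sum F S * sum G S) \<le> ((\<Sum>d\<in>D. K * \<eta> d) + K * M)\<^sup>2"
  proof (rule discrete_prekopa_leindler_line[OF S D])
    show "0 \<le> F a" if "a \<in> S" for a
      unfolding F_def using Suc.prems(2) up that by (intro sum_nonneg) blast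
    show "0 \<le> G a" if "a \<in> S" for a
      unfolding G_def using Suc.prems(3) up that by (intro sum_nonneg) blast
    show "0 \<le> K * \<eta> d" if "d \<in> D" for d using K0 \<eta> that by simp
    show "K * \<eta> d \<le> K * M" if "d \<in> D" for d using K0 \<eta> that by (simp add: mult_left_mono)
  qed (use FG in auto)
  also have "\<dots> = 4 * (K\<^sup>2 * B\<^sup>2)"
    by (simp add: B_def power_mult_distrib power_divide flip: sum_distrib_left distrib_left)
  finally have "sum F S * sum G S \<le> C * (B ^ Suc n)\<^sup>2"
    by (simp add: K2 power_mult_distrib mult_ac)
  then show ?case
    unfolding sum_PiE_lessThan_Suc F_def G_def B_def .
qed

section \<open>Many colours on the large sphere\<close>
definition radial_projection :: "nat \<Rightarrow> (nat \<Rightarrow> int) \<Rightarrow> nat \<Rightarrow> real" where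
  "radial_projection n x =
     (\<lambda>i. if i \<le> n then real_of_int (x i) / sqrt (\<Sum>i\<le>n. (real_of_int (x i))\<^sup>2) else 0)"

lemma sum_squares_pos:
  fixes x :: "nat \<Rightarrow> int"
  assumes "\<exists>i\<le>n. x i \<noteq> 0"
  shows "0 < (\<Sum>i\<le>n. (real_of_int (x i))\<^sup>2)"
proof -
  obtain i where i: "i \<le> n" "x i \<noteq> 0" using assms by blast
  then have "0 < (real_of_int (x i))\<^sup>2" by simp
  also have "\<dots> \<le> (\<Sum>i\<le>n. (real_of_int (x i))\<^sup>2)" using i by (intro member_le_sum) auto
  finally show ?thesis .
qed

lemma radial_projection_nsphere:
  assumes "\<exists>i\<le>n. x i \<noteq> 0"
  shows "radial_projection n x \<in> topspace (nsphere n)"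
proof -
  let ?N = "\<Sum>i\<le>n. (real_of_int (x i))\<^sup>2"
  have "(\<Sum>i\<le>n. (radial_projection n x i)\<^sup>2) = ?N / (sqrt ?N)\<^sup>2"
    unfolding radial_projection_def sum_divide_distrib[of _ _ "(sqrt ?N)\<^sup>2"]
    by (intro sum.cong) (auto simp: power_divide)
  also have "\<dots> = 1" using sum_squares_pos[OF assms] by simp
  finally show ?thesis by (simp add: mem_nsphere) (simp add: radial_projection_def)
qed

text \<open>
  Points of the cone over a colour class make an angle less than \<open>u\<close>, so their inner product is
  at least \<open>- \<kappa>\<close> times the product of their norms.
\<close>
lemma norm_diff_le_of_not_borsuk_adj:
  fixes x y :: "nat \<Rightarrow> int"
  assumes x: "\<exists>i\<le>n. x i \<noteq> 0" and y: "\<exists>i\<le>n. y i \<noteq> 0"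
    and adj: "\<not> borsuk_adj (round_sphere n) u (radial_projection n x) (radial_projection n y)"
    and u: "0 \<le> u" "u \<le> pi" "- \<kappa> \<le> cos u" and kappa: "0 \<le> \<kappa>"
  shows "(\<Sum>i\<le>n. (real_of_int (x i - y i))\<^sup>2)
    \<le> (1 + \<kappa>) * ((\<Sum>i\<le>n. (real_of_int (x i))\<^sup>2) + (\<Sum>i\<le>n. (real_of_int (y i))\<^sup>2))"
proof -
  define r where "r z = sqrt (\<Sum>i\<le>n. (real_of_int (z i))\<^sup>2)" for z :: "nat \<Rightarrow> int"
  let ?p = "radial_projection n"
  have r2: "(r z)\<^sup>2 = (\<Sum>i\<le>n. (real_of_int (z i))\<^sup>2)" for z
    unfolding r_def by (intro real_sqrt_pow2 sum_nonneg) auto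
  have pos: "0 < r x" "0 < r y" unfolding r_def using sum_squares_pos x y by simp_all
  have sph: "?p x \<in> topspace (nsphere n)" "?p y \<in> topspace (nsphere n)"
    using radial_projection_nsphere x y by auto
  define w where "w = (\<Sum>i\<le>n. ?p x i * ?p y i)"
  have w1: "-1 \<le> w" "w \<le> 1" unfolding w_def using nsphere_inner_bounds sph by blast+
  have "- \<kappa> \<le> w"
  proof (cases "?p x = ?p y")
    case True
    have "w = 1" unfolding w_def True using sph by (simp add: mem_nsphere flip: power2_eq_square)
    then show ?thesis using kappa by simp
  next
    case False
    then have "arccos w < u"
      using adj sph by (auto simp: borsuk_adj_def geodesic_dist_def w_def)
    then have "cos u \<le> cos (arccos w)"
      using u w1 by (intro cos_monotone_0_pi_le) (auto simp: arccos_lbound)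
    then show ?thesis using u w1 by simp
  qed
  moreover have xy: "(\<Sum>i\<le>n. real_of_int (x i) * real_of_int (y i)) = r x * r y * w"
    unfolding w_def sum_distrib_left using pos
    by (intro sum.cong) (auto simp: radial_projection_def r_def)
  ultimately have "r x * r y * (- \<kappa>) \<le> (\<Sum>i\<le>n. real_of_int (x i) * real_of_int (y i))"
    unfolding xy using pos by (intro mult_left_mono) auto
  moreover have "2 * (r x * r y) * \<kappa> \<le> ((r x)\<^sup>2 + (r y)\<^sup>2) * \<kappa>"
    using kappa sum_squares_bound[of "r x" "r y"] by (intro mult_right_mono) auto
  moreover have "(\<Sum>i\<le>n. (real_of_int (x i - y i))\<^sup>2)
      = (r x)\<^sup>2 + (r y)\<^sup>2 - 2 * (\<Sum>i\<le>n. real_of_int (x i) * real_of_int (y i))"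
    unfolding r2 sum_distrib_left sum.distrib[symmetric] sum_subtractf[symmetric]
    by (intro sum.cong) (auto simp: power2_eq_square algebra_simps)
  ultimately show ?thesis unfolding r2[symmetric] by (simp add: algebra_simps)
qed

text \<open>
  Let \<open>f\<close> be the Gaussian weight \<open>exp (- \<alpha> |x|\<^sup>2)\<close> restricted to the lattice points in the cone
  over a colour class.  For \<open>x\<close> and \<open>y\<close> in the cone,
  \<open>\<alpha> (|x|\<^sup>2 + |y|\<^sup>2) \<ge> 2 \<beta> |x - y|\<^sup>2\<close>, so the product \<open>f x * f y\<close> is bounded by the square of
  a Gaussian weight at \<open>x - y\<close>, and the discrete Prekopa--Leindler inequality bounds the mass of
  the class by \<open>B ^ Suc n\<close>.  The summand 1 is the weight of the origin, which is in no cone.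
\<close>
lemma gaussian_colour_bound:
  fixes n k K :: nat and \<alpha> \<beta> \<kappa> u :: real
  assumes c: "proper_colouring (mspace (round_sphere n)) (borsuk_adj (round_sphere n) u) k c"
    and u: "0 \<le> u" "u \<le> pi" "- \<kappa> \<le> cos u" and kappa: "0 \<le> \<kappa>"
    and beta: "0 \<le> \<beta>" and alpha: "2 * (1 + \<kappa>) * \<beta> \<le> \<alpha>"
  defines "T \<equiv> \<Sum>j=-int K..int K. exp (- \<alpha> * (real_of_int j)\<^sup>2)"
    and "B \<equiv> ((\<Sum>j=-2 * int K..2 * int K. exp (- \<beta> * (real_of_int j)\<^sup>2)) + 1) / 2"
  shows "T ^ Suc n \<le> 1 + real k * B ^ Suc n"
proof -
  let ?S = "{-int K..int K}" and ?D = "{-2 * int K..2 * int K}"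
  let ?P = "PiE {..<Suc n} (\<lambda>_. ?S)"
  let ?p = "radial_projection n"
  let ?\<eta> = "\<lambda>j. exp (- \<beta> * (real_of_int j)\<^sup>2)"
  define N where "N x = (\<Sum>i\<le>n. (real_of_int (x i))\<^sup>2)" for x :: "nat \<Rightarrow> int"
  define A where "A j = {x\<in>?P. (\<exists>i\<le>n. x i \<noteq> 0) \<and> c (?p x) = j}" for j
  have finP: "finite ?P" by (intro finite_PiE) auto
  have B0: "0 \<le> B" unfolding B_def by (intro divide_nonneg_nonneg add_nonneg_nonneg sum_nonneg) auto
  have N0: "0 \<le> N x" for x unfolding N_def by (intro sum_nonneg) auto
  have sph: "?p x \<in> mspace (round_sphere n)" if "\<exists>i\<le>n. x i \<noteq> 0" for x
    using radial_projection_nsphere that by simp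
  have class_le: "(\<Sum>x\<in>A j. exp (- \<alpha> * N x)) \<le> B ^ Suc n" for j
  proof -
    define f where "f x = (if x \<in> A j then exp (- \<alpha> * N x) else 0)" for x
    have "sum f ?P * sum f ?P \<le> 1 * (B ^ Suc n)\<^sup>2"
      unfolding B_def
    proof (rule discrete_prekopa_leindler)
      show "?\<eta> d \<le> 1" for d using beta by (simp add: mult_nonpos_nonneg)
      show "0 \<le> f x" for x by (simp add: f_def)
      show "f x * f y \<le> 1 * (\<Prod>i<Suc n. ?\<eta> (x i - y i))\<^sup>2" for x y
      proof (cases "x \<in> A j \<and> y \<in> A j")
        case True
        then have xy: "\<exists>i\<le>n. x i \<noteq> 0" "\<exists>i\<le>n. y i \<noteq> 0" "c (?p x) = c (?p y)" by (auto simp: A_def)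
        then have "\<not> borsuk_adj (round_sphere n) u (?p x) (?p y)"
          using c sph unfolding proper_colouring_def by metis
        then have "(\<Sum>i\<le>n. (real_of_int (x i - y i))\<^sup>2) \<le> (1 + \<kappa>) * (N x + N y)"
          unfolding N_def using norm_diff_le_of_not_borsuk_adj[OF xy(1,2) _ u kappa] by blast
        then have "2 * \<beta> * (\<Sum>i\<le>n. (real_of_int (x i - y i))\<^sup>2) \<le> 2 * \<beta> * ((1 + \<kappa>) * (N x + N y))"
          using beta by (intro mult_left_mono) auto
        also have "\<dots> = (2 * (1 + \<kappa>) * \<beta>) * (N x + N y)" by simp
        also have "\<dots> \<le> \<alpha> * (N x + N y)"
          using alpha N0 by (intro mult_right_mono add_nonneg_nonneg) auto
        finally have "exp (- \<alpha> * N x + - \<alpha> * N y) \<le> exp (2 * (- \<beta> * (\<Sum>i\<le>n. (real_of_int (x i - y i))\<^sup>2)))"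
          by (simp add: algebra_simps)
        also have "\<dots> = (exp (\<Sum>i\<le>n. - \<beta> * (real_of_int (x i - y i))\<^sup>2))\<^sup>2"
          by (simp only: exp_double) (simp only: sum_distrib_left)
        also have "\<dots> = (\<Prod>i<Suc n. ?\<eta> (x i - y i))\<^sup>2"
          by (simp only: exp_sum[OF finite_atMost] lessThan_Suc_atMost)
        finally have "exp (- \<alpha> * N x) * exp (- \<alpha> * N y) \<le> (\<Prod>i<Suc n. ?\<eta> (x i - y i))\<^sup>2"
          by (simp only: exp_add)
        then show ?thesis using True by (simp only: f_def if_True mult_1 simp_thms)
      next
        case False
        then have "f x * f y = 0" by (auto simp: f_def)
        then show ?thesis by (simp only: mult_1 zero_le_power2)
      qed
      show "x - y \<in> ?D" if "x \<in> ?S" "y \<in> ?S" for x y using that by simp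
    qed (simp_all add: f_def)
    moreover have "sum f ?P = (\<Sum>x\<in>A j. exp (- \<alpha> * N x))"
    proof (rule sum.mono_neutral_cong_right[OF finP])
      show "A j \<subseteq> ?P" unfolding A_def by blast
    qed (simp_all add: f_def)
    ultimately have "(\<Sum>x\<in>A j. exp (- \<alpha> * N x))\<^sup>2 \<le> (B ^ Suc n)\<^sup>2"
      by (simp only: power2_eq_square mult_1)
    then show ?thesis by (rule power2_le_imp_le) (rule zero_le_power[OF B0])
  qed
  let ?Z = "{x\<in>?P. \<forall>i\<le>n. x i = 0}"
  have "?Z \<subseteq> {restrict (\<lambda>_. 0) {..<Suc n}}"
    by (auto simp: PiE_iff extensional_def restrict_def fun_eq_iff)
  then have "(\<Sum>x\<in>?Z. exp (- \<alpha> * N x)) \<le> (\<Sum>x\<in>{restrict (\<lambda>_. 0) {..<Suc n}}. exp (- \<alpha> * N x))"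
    by (intro sum_mono2) auto
  also have "\<dots> = 1" by (simp add: N_def)
  finally have Z: "(\<Sum>x\<in>?Z. exp (- \<alpha> * N x)) \<le> 1" .
  have colour: "x \<in> A (c (?p x)) \<and> c (?p x) < k" if "x \<in> ?P" "\<exists>i\<le>n. x i \<noteq> 0" for x
  proof
    show "x \<in> A (c (?p x))" using that by (simp only: A_def mem_Collect_eq simp_thms)
    show "c (?p x) < k"
      using c sph[OF that(2)] unfolding proper_colouring_def by blast
  qed
  have "?P = ?Z \<union> (\<Union>j\<in>{..<k}. A j)"
  proof (rule antisym)
    show "?P \<subseteq> ?Z \<union> (\<Union>j\<in>{..<k}. A j)" using colour by blast
    show "?Z \<union> (\<Union>j\<in>{..<k}. A j) \<subseteq> ?P" unfolding A_def by blast
  qed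
  moreover have "(\<Sum>x\<in>?Z \<union> (\<Union>j\<in>{..<k}. A j). exp (- \<alpha> * N x))
      = (\<Sum>x\<in>?Z. exp (- \<alpha> * N x)) + (\<Sum>x\<in>(\<Union>j\<in>{..<k}. A j). exp (- \<alpha> * N x))"
  proof (rule sum.union_disjoint)
    show "finite ?Z" using finP by simp
    show "finite (\<Union>j\<in>{..<k}. A j)" unfolding A_def using finP by simp
    show "?Z \<inter> (\<Union>j\<in>{..<k}. A j) = {}" unfolding A_def by blast
  qed
  ultimately have "(\<Sum>x\<in>?P. exp (- \<alpha> * N x))
      = (\<Sum>x\<in>?Z. exp (- \<alpha> * N x)) + (\<Sum>x\<in>(\<Union>j\<in>{..<k}. A j). exp (- \<alpha> * N x))"
    by (simp only:)
  also have "(\<Sum>x\<in>(\<Union>j\<in>{..<k}. A j). exp (- \<alpha> * N x)) = (\<Sum>j<k. \<Sum>x\<in>A j. exp (- \<alpha> * N x))"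
    using finP unfolding A_def by (intro sum.UNION_disjoint) (simp_all, blast)
  also have "\<dots> \<le> (\<Sum>j<k. B ^ Suc n)" by (intro sum_mono class_le)
  finally have "(\<Sum>x\<in>?P. exp (- \<alpha> * N x)) \<le> 1 + real k * B ^ Suc n" using Z by simp
  moreover have "(\<Sum>x\<in>?P. exp (- \<alpha> * N x)) = T ^ Suc n"
  proof -
    have "T ^ Suc n = (\<Prod>i<Suc n. \<Sum>j\<in>?S. exp (- \<alpha> * (real_of_int j)\<^sup>2))"
      by (simp add: T_def)
    also have "\<dots> = (\<Sum>x\<in>?P. \<Prod>i<Suc n. exp (- \<alpha> * (real_of_int (x i))\<^sup>2))"
      by (intro prod_sum_PiE) auto
    also have "\<dots> = (\<Sum>x\<in>?P. exp (- \<alpha> * N x))"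
      by (intro sum.cong refl)
         (simp only: N_def sum_distrib_left exp_sum[OF finite_atMost] lessThan_Suc_atMost)
    finally show ?thesis ..
  qed
  ultimately show ?thesis by simp
qed

lemma sum_symmetric_int_interval:
  fixes f :: "int \<Rightarrow> real"
  assumes "\<And>j. f (- j) = f j"
  shows "(\<Sum>j=-int K..int K. f j) = f 0 + 2 * (\<Sum>j=1..K. f (int j))"
proof (induction K)
  case (Suc K)
  have "{-int (Suc K)..int (Suc K)} = insert (-int (Suc K)) (insert (int (Suc K)) {-int K..int K})"
    by auto
  then show ?case using Suc assms[of "int (Suc K)"] by simp
qed simp

text \<open>
  Sampling a decreasing function at every \<open>a\<close>-th point only and multiplying by \<open>a\<close> changes its sum
  by at most \<open>a\<close> times its first value.  This compares Gaussian sums of different widths with each other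
  without evaluating any of them.
\<close>
lemma antimono_sum_blocks:
  fixes \<phi> :: "nat \<Rightarrow> real"
  assumes anti: "antimono \<phi>"
  shows "a * (\<Sum>j<n. \<phi> (Suc j * a)) \<le> (\<Sum>i<n * a. \<phi> (Suc i))"
    and "(\<Sum>i<n * a. \<phi> i) \<le> a * (\<Sum>j<n. \<phi> (j * a))"
proof -
  have "a * (\<Sum>j<n. \<phi> (Suc j * a)) = (\<Sum>j<n. \<Sum>i\<in>{j * a..<j * a + a}. \<phi> (Suc j * a))"
    by (simp add: sum_distrib_left)
  also have "\<dots> \<le> (\<Sum>j<n. \<Sum>i\<in>{j * a..<j * a + a}. \<phi> (Suc i))"
    by (intro sum_mono antimonoD[OF anti]) simp
  also have "\<dots> = (\<Sum>i<n * a. \<phi> (Suc i))" by (rule sum.nat_group)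
  finally show "a * (\<Sum>j<n. \<phi> (Suc j * a)) \<le> (\<Sum>i<n * a. \<phi> (Suc i))" .
  have "(\<Sum>i<n * a. \<phi> i) = (\<Sum>j<n. \<Sum>i\<in>{j * a..<j * a + a}. \<phi> i)" by (rule sum.nat_group[symmetric])
  also have "\<dots> \<le> (\<Sum>j<n. \<Sum>i\<in>{j * a..<j * a + a}. \<phi> (j * a))"
    by (intro sum_mono antimonoD[OF anti]) simp
  also have "\<dots> = a * (\<Sum>j<n. \<phi> (j * a))" by (simp add: sum_distrib_left)
  finally show "(\<Sum>i<n * a. \<phi> i) \<le> a * (\<Sum>j<n. \<phi> (j * a))" .
qed

text \<open>
  With \<open>\<alpha> = (13 \<epsilon>)\<^sup>2\<close> and \<open>\<beta> = (7 \<epsilon>)\<^sup>2\<close> the condition on the weights reads \<open>168 \<le> 169\<close>.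
  Let \<open>W\<close> be the sum of \<open>exp (- (\<epsilon> i)\<^sup>2)\<close> over \<open>i\<close>; it is of order \<open>1 / \<epsilon>\<close>.
  Up to bounded errors the left sum is \<open>W / 7\<close> and the right sum is \<open>2 W / 13\<close>,
  with quotient \<open>14 / 13 > 21 / 20\<close>, so a small \<open>\<epsilon> = 1 / K\<close> suffices.
\<close>
lemma gaussian_sum_ratio:
  obtains K :: nat and \<alpha> \<beta> :: real where "0 \<le> \<beta>" "2 * (1 + 5 / 7) * \<beta> \<le> \<alpha>"
    "21 / 20 * (((\<Sum>j=-2 * int K..2 * int K. exp (- \<beta> * (real_of_int j)\<^sup>2)) + 1) / 2)
       \<le> (\<Sum>j=-int K..int K. exp (- \<alpha> * (real_of_int j)\<^sup>2))"
proof -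
  define K :: nat where "K = 3000"
  define \<phi> where "\<phi> i = exp (- (real i / K)\<^sup>2)" for i :: nat
  define W where "W = (\<Sum>i<K * 13. \<phi> i)"
  have K0: "0 < K" by (simp add: K_def)
  have anti: "antimono \<phi>"
    by (auto simp: antimono_def \<phi>_def intro!: power_mono divide_right_mono)
  have scaled: "exp (- (real a / K)\<^sup>2 * (real_of_int (int j))\<^sup>2) = \<phi> (j * a)" for a j :: nat
    by (simp add: \<phi>_def power_divide power_mult_distrib mult_ac)
  have split: "(\<Sum>j=1..m. h j) = (\<Sum>j<m. h (Suc j))" for m and h :: "nat \<Rightarrow> real"
    by (simp add: sum.atLeast1_atMost_eq)
  have "(\<Sum>j=-2 * int K..2 * int K. exp (- (real 7 / K)\<^sup>2 * (real_of_int j)\<^sup>2))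
      = 1 + 2 * (\<Sum>j<2 * K. \<phi> (Suc j * 7))"
    using sum_symmetric_int_interval[of "\<lambda>j. exp (- (real 7 / K)\<^sup>2 * (real_of_int j)\<^sup>2)" "2 * K"]
    by (simp only: scaled split) simp
  moreover have "7 * (\<Sum>j<2 * K. \<phi> (Suc j * 7)) \<le> W + 1"
  proof -
    have "real 7 * (\<Sum>j<2 * K. \<phi> (Suc j * 7)) \<le> (\<Sum>i<2 * K * 7. \<phi> (Suc i))"
      by (rule antimono_sum_blocks[OF anti])
    also have "\<dots> = (\<Sum>i<K * 13. \<phi> (Suc i)) + (\<Sum>i=K*13..<K*14. \<phi> (Suc i))"
      using sum.atLeastLessThan_concat[of 0 "K * 13" "K * 14" "\<lambda>i. \<phi> (Suc i)"]
      by (simp add: atLeast0LessThan mult.commute)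
    also have "(\<Sum>i<K * 13. \<phi> (Suc i)) \<le> W"
      unfolding W_def by (intro sum_mono antimonoD[OF anti]) simp
    also have "(\<Sum>i=K*13..<K*14. \<phi> (Suc i)) \<le> (\<Sum>i=K*13..<K*14. \<phi> (K * 13))"
      by (intro sum_mono antimonoD[OF anti]) simp
    also have "\<dots> = K * exp (-169)" using K0 by (simp add: \<phi>_def)
    also have "\<dots> \<le> 1"
    proof -
      have "real K \<le> 2 ^ 169" by (simp add: K_def)
      also have "\<dots> \<le> exp 1 ^ 169" using exp_ge_add_one_self[of 1] by (intro power_mono) auto
      also have "\<dots> = exp 169" by (simp flip: exp_of_nat_mult)
      finally show ?thesis by (simp add: exp_minus field_simps)
    qed
    finally show ?thesis by simp
  qed
  moreover have "(\<Sum>j=-int K..int K. exp (- (real 13 / K)\<^sup>2 * (real_of_int j)\<^sup>2))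
      = 1 + 2 * (\<Sum>j<K. \<phi> (Suc j * 13))"
    using sum_symmetric_int_interval[of "\<lambda>j. exp (- (real 13 / K)\<^sup>2 * (real_of_int j)\<^sup>2)" K]
    by (simp only: scaled split) simp
  moreover have "W \<le> 13 * (1 + (\<Sum>j<K. \<phi> (Suc j * 13)))"
  proof -
    have "W \<le> real 13 * (\<Sum>j<K. \<phi> (j * 13))"
      unfolding W_def by (rule antimono_sum_blocks[OF anti])
    also have "(\<Sum>j<K. \<phi> (j * 13)) \<le> (\<Sum>j<Suc K. \<phi> (j * 13))"
      by (simp add: \<phi>_def)
    also have "\<dots> = 1 + (\<Sum>j<K. \<phi> (Suc j * 13))"
      by (subst sum.lessThan_Suc_shift) (simp add: \<phi>_def)
    finally show ?thesis by simp
  qed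
  moreover have "1000 \<le> W"
  proof -
    have "1 / 3 \<le> exp (- 1 :: real)" using exp_le by (simp add: exp_minus field_simps)
    then have "1000 \<le> (\<Sum>i<K. \<phi> K)" by (simp add: \<phi>_def K_def)
    also have "\<dots> \<le> (\<Sum>i<K. \<phi> i)" by (intro sum_mono antimonoD[OF anti]) simp
    also have "\<dots> \<le> W" unfolding W_def by (intro sum_mono2) (auto simp: \<phi>_def)
    finally show ?thesis .
  qed
  ultimately have "21 / 20 * (((\<Sum>j=-2 * int K..2 * int K. exp (- (real 7 / K)\<^sup>2 * (real_of_int j)\<^sup>2)) + 1) / 2)
      \<le> (\<Sum>j=-int K..int K. exp (- (real 13 / K)\<^sup>2 * (real_of_int j)\<^sup>2))"
    by (simp only:) argo
  then show ?thesis
    by (intro that[of "(real 7 / K)\<^sup>2" "(real 13 / K)\<^sup>2" K]) (auto simp: power_divide divide_right_mono)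
qed

text \<open>
  At \<open>u = 3 pi / 4\<close> the constant \<open>\<kappa> = 5 / 7\<close> just exceeds \<open>- cos u = 1 / sqrt 2\<close>.
\<close>
lemma borsuk_chi_sphere_30000_gt:
  "enat (361 ^ 240) < borsuk_chi (round_sphere 30000) (3 * pi / 4)"
proof (rule ccontr)
  assume "\<not> ?thesis"
  then have "chromatic_number (mspace (round_sphere 30000)) (borsuk_adj (round_sphere 30000) (3 * pi / 4))
      \<le> enat (361 ^ 240)" by (simp only: borsuk_chi_def not_less)
  then obtain k c where k: "k \<le> 361 ^ 240"
    and c: "proper_colouring (mspace (round_sphere 30000)) (borsuk_adj (round_sphere 30000) (3 * pi / 4)) k c"
    by (rule chromatic_number_le_D)
  have "cos (3 * pi / 4) = - cos (pi / 4)"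
    using cos_minus_pi[of "pi / 4"] cos_minus[of "3 * pi / 4"] by (simp add: field_simps)
  moreover have "sqrt 2 \<le> 10 / 7" by (intro real_le_lsqrt) (auto simp: power_divide)
  ultimately have cos: "- (5 / 7) \<le> cos (3 * pi / 4)" by (simp add: cos_45)
  obtain K \<alpha> \<beta> where g: "0 \<le> \<beta>" "2 * (1 + 5 / 7) * \<beta> \<le> \<alpha>"
    "21 / 20 * (((\<Sum>j=-2 * int K..2 * int K. exp (- \<beta> * (real_of_int j)\<^sup>2)) + 1) / 2)
       \<le> (\<Sum>j=-int K..int K. exp (- \<alpha> * (real_of_int j)\<^sup>2))"
    by (rule gaussian_sum_ratio)
  define B where "B = ((\<Sum>j=-2 * int K..2 * int K. exp (- \<beta> * (real_of_int j)\<^sup>2)) + 1) / 2"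
  define T where "T = (\<Sum>j=-int K..int K. exp (- \<alpha> * (real_of_int j)\<^sup>2))"
  have "1 = (\<Sum>j\<in>{0::int}. exp (- \<beta> * (real_of_int j)\<^sup>2))" by simp
  also have "\<dots> \<le> (\<Sum>j=-2 * int K..2 * int K. exp (- \<beta> * (real_of_int j)\<^sup>2))"
    by (intro sum_mono2) auto
  finally have B1: "1 \<le> B" by (simp add: B_def)
  define N :: nat where "N = Suc 30000"
  have BN: "1 \<le> B ^ N" using B1 by simp
  have "(21 / 20) ^ N * B ^ N \<le> T ^ N"
    unfolding power_mult_distrib[symmetric] using g(3) B1 by (intro power_mono) (auto simp: B_def T_def)
  also have "\<dots> \<le> 1 + real k * B ^ N"
    unfolding T_def B_def N_def
    by (rule gaussian_colour_bound[OF c _ _ cos _ g(1,2)]) auto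
  also have "\<dots> \<le> (1 + real k) * B ^ N" using BN by (simp add: algebra_simps)
  finally have "(21 / 20) ^ N \<le> 1 + real k" using BN by simp
  also have "\<dots> \<le> 1 + 361 ^ 240" using k by (metis add_left_mono of_nat_le_iff of_nat_numeral of_nat_power)
  finally have up: "(21 / 20) ^ N \<le> 1 + (361::real) ^ 240" .
  define X Y :: real where "X = 361 ^ 240" and "Y = 362 ^ 240"
  have XY: "X \<le> Y" "362 \<le> Y" unfolding X_def Y_def by (intro power_mono self_le_power; simp)+
  have "(362::real) \<le> (21 / 20) ^ 125" by (simp add: power_divide)
  then have "Y \<le> ((21 / 20) ^ 125) ^ 240" unfolding Y_def by (intro power_mono) auto
  also have "\<dots> = (21 / 20) ^ (125 * 240)" by (rule power_mult[symmetric])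
  finally have "21 / 20 * Y \<le> 21 / 20 * (21 / 20) ^ (125 * 240)" by simp
  also have "\<dots> = (21 / 20) ^ Suc (125 * 240)" by (rule power_Suc[symmetric])
  also have "Suc (125 * 240) = N" by (simp add: N_def)
  also have "(21 / 20) ^ N \<le> 1 + X" using up by (simp only: X_def)
  finally have "21 / 20 * Y \<le> 1 + X" .
  with XY show False by linarith
qed

section \<open>Nearly orthogonal lines from a Reed--Solomon code\<close>

text \<open>
  The bound on the number of roots over the field with \<open>p\<close> elements, phrased with integer
  representatives: after splitting off the factor \<open>[:- a, 1:]\<close> of a root \<open>a\<close>, any other root \<open>b\<close>
  is a root of the quotient, because \<open>b - a\<close> is a unit modulo \<open>p\<close>.
\<close>
lemma prime_dvd_coeffs_of_many_roots:
  fixes P :: "int poly" and p :: int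
  assumes p: "prime p" and "degree P \<le> n" and "R \<subseteq> {0..<p}" and "n < card R"
    and "\<And>a. a \<in> R \<Longrightarrow> p dvd poly P a"
  shows "[:p:] dvd P"
  using assms(2-)
proof (induction n arbitrary: P R)
  case 0
  then obtain a where a: "a \<in> R" by fastforce
  obtain c where "P = [:c:]" using 0 by (metis degree_eq_zeroE le_zero_eq)
  then show ?case using 0(4)[OF a] by (simp add: const_poly_dvd_const_poly_iff)
next
  case (Suc n)
  have finR: "finite R" using Suc.prems(2) finite_subset by blast
  obtain a where a: "a \<in> R" using Suc.prems(3) by fastforce
  define Q where "Q = synthetic_div P a"
  have P: "P = [:- a, 1:] * Q + [:poly P a:]"
    unfolding Q_def by (rule synthetic_div_correct'[symmetric])
  have "[:p:] dvd Q"
  proof (rule Suc.IH)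
    show "degree Q \<le> n" using Suc.prems(1) by (simp add: Q_def degree_synthetic_div)
    show "R - {a} \<subseteq> {0..<p}" using Suc.prems(2) by auto
    show "n < card (R - {a})" using Suc.prems(3) a finR by simp
    fix b assume b: "b \<in> R - {a}"
    have "poly P b = (b - a) * poly Q b + poly P a"
      by (subst P) (simp add: algebra_simps)
    then have "p dvd (b - a) * poly Q b"
      using Suc.prems(4) a b by (metis DiffE dvd_add_left_iff)
    moreover have "\<not> p dvd b - a"
    proof
      assume "p dvd b - a"
      then have "\<bar>p\<bar> \<le> \<bar>b - a\<bar>" using b by (intro dvd_imp_le_int) auto
      moreover have "a \<in> {0..<p}" "b \<in> {0..<p}" using Suc.prems(2) a b by auto
      ultimately show False by auto
    qed
    ultimately show "p dvd poly Q b" using p by (simp add: prime_dvd_mult_iff)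
  qed
  moreover have "[:p:] dvd [:poly P a:]"
    using Suc.prems(4)[OF a] by (simp add: const_poly_dvd_const_poly_iff)
  ultimately show ?case by (subst P) (intro dvd_add dvd_mult)
qed

lemma card_polynomial_agreements_le:
  fixes c c' :: "nat \<Rightarrow> nat" and p d :: nat
  assumes p: "prime p" and c: "c \<in> PiE {..d} (\<lambda>_. {..<p})" and c': "c' \<in> PiE {..d} (\<lambda>_. {..<p})"
    and ne: "c \<noteq> c'"
  shows "card {a\<in>{..<p}. (\<Sum>i\<le>d. c i * a ^ i) mod p = (\<Sum>i\<le>d. c' i * a ^ i) mod p} \<le> d"
proof (rule ccontr)
  let ?R = "{a\<in>{..<p}. (\<Sum>i\<le>d. c i * a ^ i) mod p = (\<Sum>i\<le>d. c' i * a ^ i) mod p}"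
  assume "\<not> card ?R \<le> d"
  define P where "P = (\<Sum>i\<le>d. monom (int (c i) - int (c' i)) i)"
  have coeff: "coeff P i = int (c i) - int (c' i)" if "i \<le> d" for i
    unfolding P_def coeff_sum coeff_monom using that by (simp add: sum.delta')
  have "[:int p:] dvd P"
  proof (rule prime_dvd_coeffs_of_many_roots)
    show "prime (int p)" using p by simp
    show "degree P \<le> d" unfolding P_def
      by (intro degree_sum_le) (auto intro: order_trans[OF degree_monom_le])
    show "int ` ?R \<subseteq> {0..<int p}" by auto
    show "d < card (int ` ?R)" using \<open>\<not> card ?R \<le> d\<close> by (simp add: card_image)
    fix b assume "b \<in> int ` ?R"
    then obtain a where a: "b = int a" "(\<Sum>i\<le>d. c i * a ^ i) mod p = (\<Sum>i\<le>d. c' i * a ^ i) mod p"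
      by auto
    then have "int (\<Sum>i\<le>d. c i * a ^ i) mod int p = int (\<Sum>i\<le>d. c' i * a ^ i) mod int p"
      by (metis of_nat_mod)
    then have "int p dvd int (\<Sum>i\<le>d. c i * a ^ i) - int (\<Sum>i\<le>d. c' i * a ^ i)"
      by (rule mod_eq_dvd_iff[THEN iffD1])
    also have "int (\<Sum>i\<le>d. c i * a ^ i) - int (\<Sum>i\<le>d. c' i * a ^ i) = poly P b"
      unfolding P_def a(1) by (simp add: poly_sum poly_monom left_diff_distrib sum_subtractf)
    finally show "int p dvd poly P b" .
  qed
  then have "int p dvd int (c i) - int (c' i)" if "i \<le> d" for i
    using coeff[OF that] by (metis const_poly_dvd_iff)
  moreover have "c i < p" "c' i < p" if "i \<le> d" for i using c c' that by auto
  ultimately have "c i = c' i" if "i \<le> d" for i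
    using that by (metis mod_eq_dvd_iff mod_less nat_int of_nat_mod)
  then have "c = c'" using c c' by (intro PiE_ext) auto
  then show False using ne by simp
qed

text \<open>
  The vectors are the normalised indicators of the graphs of the polynomials of degree at most \<open>d\<close>
  over the field with \<open>p\<close> elements.  Their coordinates are indexed by the pairs \<open>(a, b)\<close> of
  field elements, encoded as \<open>a * p + b\<close>.  The inner product of two of them is the proportion
  of arguments where the polynomials agree.
\<close>
lemma reed_solomon_directions:
  fixes p d m N :: nat
  assumes p: "prime p" and m: "p * p \<le> Suc m" and N: "N \<le> p ^ Suc d"
  obtains v :: "nat \<Rightarrow> nat \<Rightarrow> real" where "\<And>i. i < N \<Longrightarrow> v i \<in> topspace (nsphere m)"
    "\<And>i j. \<lbrakk>i < N; j < N; i \<noteq> j\<rbrakk> \<Longrightarrow> \<bar>\<Sum>k\<le>m. v i k * v j k\<bar> \<le> d / p"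
proof -
  let ?C = "PiE {..d} (\<lambda>_. {..<p})"
  have p0: "0 < p" using p prime_gt_0_nat by blast
  have "card {..<N} \<le> card ?C" using N by (simp add: card_PiE)
  then obtain e where e: "e ` {..<N} \<subseteq> ?C" "inj_on e {..<N}"
    using card_le_inj[of "{..<N}" ?C] by (auto intro!: finite_PiE)
  define val where "val c a = (\<Sum>i\<le>d. c i * a ^ i) mod p" for c :: "nat \<Rightarrow> nat" and a
  define w :: "(nat \<Rightarrow> nat) \<Rightarrow> nat \<Rightarrow> real" where
    "w c k = (if k < p * p \<and> k mod p = val c (k div p) then 1 / sqrt p else 0)" for c k
  have val: "val c a < p" for c a using p0 by (simp add: val_def)
  have inner: "(\<Sum>k\<le>m. w c k * w c' k) = card {a\<in>{..<p}. val c a = val c' a} / p" for c c'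
  proof -
    let ?E = "{k. k < p * p \<and> k mod p = val c (k div p) \<and> k mod p = val c' (k div p)}"
    let ?A = "{a\<in>{..<p}. val c a = val c' a}"
    have "(\<Sum>k\<le>m. w c k * w c' k) = (\<Sum>k\<in>?E. 1 / p)"
      using m by (intro sum.mono_neutral_cong_right) (auto simp: w_def)
    also have "?E = (\<lambda>a. a * p + val c a) ` ?A"
    proof (intro equalityI subsetI)
      fix k assume k: "k \<in> ?E"
      then have "k div p < p" by (auto simp: less_mult_imp_div_less)
      moreover have "k = k div p * p + val c (k div p)"
        using k div_mult_mod_eq[of k p] by simp
      ultimately show "k \<in> (\<lambda>a. a * p + val c a) ` ?A"
        using k by (intro image_eqI[of _ _ "k div p"]) auto
    next
      fix k assume "k \<in> (\<lambda>a. a * p + val c a) ` ?A"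
      then obtain a where a: "k = a * p + val c a" "a < p" "val c a = val c' a" by auto
      have "k < Suc a * p" using a val[of c a] by simp
      also have "\<dots> \<le> p * p" using a by (intro mult_le_mono1) simp
      finally show "k \<in> ?E" using a val[of c a] p0 by simp
    qed
    also have "(\<Sum>k\<in>(\<lambda>a. a * p + val c a) ` ?A. 1 / real p) = card ((\<lambda>a. a * p + val c a) ` ?A) / p"
      by simp
    also have "card ((\<lambda>a. a * p + val c a) ` ?A) = card ?A"
    proof (intro card_image inj_onI)
      fix a b assume "a * p + val c a = b * p + val c b"
      then have "(a * p + val c a) div p = (b * p + val c b) div p" by simp
      then show "a = b" using val p0 by simp
    qed
    finally show ?thesis .
  qed
  have "w (e i) \<in> topspace (nsphere m)" for i
    using inner[of "e i" "e i"] m p0 by (auto simp: mem_nsphere w_def power2_eq_square)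
  moreover have "\<bar>\<Sum>k\<le>m. w (e i) k * w (e j) k\<bar> \<le> d / p" if "i < N" "j < N" "i \<noteq> j" for i j
  proof -
    have "e i \<noteq> e j" using that e(2) by (auto dest: inj_onD)
    moreover have "e i \<in> ?C" "e j \<in> ?C" using that e(1) by auto
    ultimately have "card {a\<in>{..<p}. val (e i) a = val (e j) a} \<le> d"
      unfolding val_def using card_polynomial_agreements_le[OF p] by blast
    then show ?thesis unfolding inner by (simp add: divide_right_mono)
  qed
  ultimately show ?thesis by (intro that[of "\<lambda>i. w (e i)"])
qed

section \<open>Cross-polytopes in Vietoris--Rips complexes\<close>
lemma continuous_map_closed_simplex_realization:
  assumes "\<sigma> \<in> K"
  shows "continuous_map (subtopology (powertop_real UNIV) (closed_simplex \<sigma>)) (geometric_realization K) (\<lambda>t. t)"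
  unfolding continuous_map_def
proof (intro conjI allI impI)
  show "(\<lambda>t. t) \<in> topspace (subtopology (powertop_real UNIV) (closed_simplex \<sigma>)) \<rightarrow> topspace (geometric_realization K)"
    using assms by (auto simp: topspace_geometric_realization)
  fix U assume "openin (geometric_realization K) U"
  then have "openin (subtopology (powertop_real UNIV) (closed_simplex \<sigma>)) (U \<inter> closed_simplex \<sigma>)"
    using assms by (simp add: openin_geometric_realization realization_open_def)
  moreover have "{x \<in> topspace (subtopology (powertop_real UNIV) (closed_simplex \<sigma>)). x \<in> U} = U \<inter> closed_simplex \<sigma>"
    by auto
  ultimately show "openin (subtopology (powertop_real UNIV) (closed_simplex \<sigma>))
      {x \<in> topspace (subtopology (powertop_real UNIV) (closed_simplex \<sigma>)). x \<in> U}" by simp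
qed

text \<open>
  The odd map is the radial projection of the round sphere to the boundary of the cross-polytope:
  \<open>x\<close> goes to the point with weight \<open>|x i|\<close>, divided by the sum of all of them, at the vertex
  \<open>v i\<close> or its antipode, according to the sign of \<open>x i\<close>.  The domain is covered by the finitely
  many closed orthants, and each of them is mapped into a single closed simplex, where the weak
  topology agrees with the product topology; so continuity can be checked coordinatewise.
\<close>
lemma coindex_vietoris_rips_ge:
  fixes v :: "nat \<Rightarrow> nat \<Rightarrow> real"
  assumes v: "\<And>i. i \<le> n \<Longrightarrow> v i \<in> topspace (nsphere m)"
    and inner: "\<And>i j. \<lbrakk>i \<le> n; j \<le> n; i \<noteq> j\<rbrakk> \<Longrightarrow> \<bar>\<Sum>k\<le>m. v i k * v j k\<bar> \<le> \<kappa>"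
    and kappa: "0 \<le> \<kappa>" "\<kappa> \<le> 1"
  shows "enat n \<le> coindex (vietoris_rips (round_sphere m) (arccos (- \<kappa>))) vr_antipode"
proof -
  let ?K = "vr_complex (round_sphere m) (arccos (- \<kappa>))"
  define L where "L x = (\<Sum>i\<le>n. \<bar>x i\<bar>)" for x :: "nat \<Rightarrow> real"
  define t where "t x w = (\<Sum>i\<le>n. (if w = v i then max (x i) 0 else 0)
      + (if w = antipode (v i) then max (- x i) 0 else 0)) / L x" for x :: "nat \<Rightarrow> real" and w
  define orthant where "orthant S = {x \<in> topspace (nsphere n). (\<forall>i\<in>S. 0 \<le> x i) \<and> (\<forall>i\<in>{..n} - S. x i \<le> 0)}"
    for S
  define s where "s S i = (if i \<in> S then v i else antipode (v i))" for S i
  have L0: "0 < L x" if "x \<in> topspace (nsphere n)" for x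
  proof (rule ccontr)
    assume "\<not> 0 < L x"
    then have "L x = 0" unfolding L_def by (metis abs_ge_zero order_le_less sum_nonneg)
    then have "\<forall>i\<le>n. x i = 0" by (simp add: L_def sum_nonneg_eq_0_iff)
    then show False using that by (simp add: mem_nsphere)
  qed
  have simplex: "s S ` {..n} \<in> ?K" for S
  proof -
    have mem: "s S i \<in> topspace (nsphere m)" if "i \<le> n" for i
      using v[OF that] antipode_nsphere by (simp add: s_def)
    have "geodesic_dist m (s S i) (s S j) \<le> arccos (- \<kappa>)" if ij: "i \<le> n" "j \<le> n" for i j
    proof (cases "i = j")
      case True
      then show ?thesis using mem[OF ij(1)] kappa
        by (simp add: geodesic_dist_def mem_nsphere arccos_lbound flip: power2_eq_square)
    next
      case False
      have "\<bar>\<Sum>k\<le>m. s S i k * s S j k\<bar> = \<bar>\<Sum>k\<le>m. v i k * v j k\<bar>"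
        by (simp add: s_def antipode_def sum_negf)
      then have "- \<kappa> \<le> (\<Sum>k\<le>m. s S i k * s S j k)" using inner[OF ij False] by linarith
      then show ?thesis
        using mem ij kappa nsphere_inner_bounds[OF mem[OF ij(1)] mem[OF ij(2)]]
        by (simp add: geodesic_dist_def arccos_le_arccos)
    qed
    then show ?thesis using mem by (auto simp: vr_complex_def)
  qed
  have t_mem: "t x \<in> closed_simplex (s S ` {..n})" if "x \<in> orthant S" for x S
  proof -
    have x: "x \<in> topspace (nsphere n)" using that by (simp add: orthant_def)
    \<comment> \<open>on an orthant only one of the two vertices \<open>\<plusminus> v i\<close> gets a positive weight\<close>
    have summand: "(if w = v i then max (x i) 0 else 0) + (if w = antipode (v i) then max (- x i) 0 else 0)
        = (if w = s S i then \<bar>x i\<bar> else 0)" if "i \<le> n" for i w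
      using \<open>x \<in> orthant S\<close> that by (cases "i \<in> S") (auto simp: orthant_def s_def)
    have t: "t x w = (\<Sum>i\<le>n. if w = s S i then \<bar>x i\<bar> else 0) / L x" for w
      unfolding t_def using summand by (intro arg_cong2[of _ _ _ _ "(/)"] sum.cong) auto
    have "(\<Sum>w\<in>s S ` {..n}. t x w) = (\<Sum>i\<le>n. \<Sum>w\<in>s S ` {..n}. if w = s S i then \<bar>x i\<bar> else 0) / L x"
      unfolding t sum_divide_distrib[symmetric] by (subst sum.swap) simp
    also have "\<dots> = (\<Sum>i\<le>n. \<bar>x i\<bar>) / L x"
      by (intro arg_cong2[of _ _ _ _ "(/)"] sum.cong refl) (simp add: sum.delta)
    also have "\<dots> = 1" using L0[OF x] by (simp add: L_def)
    finally show ?thesis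
      using L0[OF x] by (auto simp: closed_simplex_def t intro!: divide_nonneg_pos sum_nonneg sum.neutral)
  qed
  have "continuous_map (nsphere n) (vietoris_rips (round_sphere m) (arccos (- \<kappa>))) t"
  proof (rule pasting_lemma_closed[where I = "Pow {..n}" and T = orthant and f = "\<lambda>_. t"])
    have ns: "nsphere n = top_of_set (topspace (nsphere n))"
      by (simp add: nsphere euclidean_product_topology)
    have "closed (orthant S)" for S
    proof -
      have "orthant S = {x. \<forall>i>n. x i = 0} \<inter> {x. (\<Sum>i\<le>n. (x i)\<^sup>2) = 1} \<inter> {x. \<forall>i\<in>S. 0 \<le> x i}
          \<inter> {x. \<forall>i\<in>{..n} - S. x i \<le> 0}"
        by (auto simp: orthant_def mem_nsphere)
      also have "closed \<dots>"
        unfolding Ball_def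
        by (intro closed_Int closed_Collect_all closed_Collect_imp closed_Collect_eq
              closed_Collect_le open_Collect_const continuous_intros
              continuous_on_product_coordinates)
      finally show ?thesis .
    qed
    then show "closedin (nsphere n) (orthant S)" for S
      by (subst ns) (auto intro!: closed_subset simp: orthant_def)
    fix S
    have coord: "continuous_on (topspace (nsphere n)) (\<lambda>x. x i)" for i
      by (rule continuous_on_subset[OF continuous_on_product_coordinates]) simp
    have "continuous_on (topspace (nsphere n)) t"
    proof (rule continuous_on_coordinatewise_then_product)
      fix w
      show "continuous_on (topspace (nsphere n)) (\<lambda>x. t x w)"
        unfolding t_def
      proof (intro continuous_intros ballI)
        show "L x \<noteq> 0" if "x \<in> topspace (nsphere n)" for x using L0[OF that] by simp
        show "continuous_on (topspace (nsphere n)) L"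
          unfolding L_def by (intro continuous_intros coord)
        show "continuous_on (topspace (nsphere n)) (\<lambda>x. if w = v i then max (x i) 0 else 0)" for i
          by (cases "w = v i") (auto intro!: continuous_intros coord)
        show "continuous_on (topspace (nsphere n)) (\<lambda>x. if w = antipode (v i) then max (- x i) 0 else 0)" for i
          by (cases "w = antipode (v i)") (auto intro!: continuous_intros coord)
      qed
    qed
    then have "continuous_map (nsphere n) (powertop_real UNIV) t"
      by (subst ns) (simp add: euclidean_product_topology)
    then have "continuous_map (subtopology (nsphere n) (orthant S))
        (subtopology (powertop_real UNIV) (closed_simplex (s S ` {..n}))) t"
      by (intro continuous_map_into_subtopology continuous_map_from_subtopology) (simp_all add: Pi_def t_mem)
    then have "continuous_map (subtopology (nsphere n) (orthant S))
        (vietoris_rips (round_sphere m) (arccos (- \<kappa>))) ((\<lambda>u. u) \<circ> t)"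
      unfolding vietoris_rips_def
      by (rule continuous_map_compose[OF _ continuous_map_closed_simplex_realization[OF simplex]])
    then show "continuous_map (subtopology (nsphere n) (orthant S))
        (vietoris_rips (round_sphere m) (arccos (- \<kappa>))) t"
      by (simp only: comp_def)
  next
    fix x assume "x \<in> topspace (nsphere n)"
    then have "{i. i \<le> n \<and> 0 \<le> x i} \<in> Pow {..n} \<and> x \<in> orthant {i. i \<le> n \<and> 0 \<le> x i} \<and> t x = t x"
      unfolding orthant_def by force
    then show "\<exists>S. S \<in> Pow {..n} \<and> x \<in> orthant S \<and> t x = t x" by (rule exI)
  qed simp_all
  moreover have "t (antipode x) = vr_antipode (t x)" for x
  proof
    fix w
    have "antipode (antipode y) = y" for y by (simp add: antipode_def)
    then have "antipode w = v i \<longleftrightarrow> w = antipode (v i)" "antipode w = antipode (v i) \<longleftrightarrow> w = v i" for i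
      by metis+
    moreover have "L (antipode x) = L x" by (simp add: L_def antipode_def)
    ultimately show "t (antipode x) w = vr_antipode (t x) w"
      by (simp add: t_def vr_antipode_def antipode_def[of x] add.commute cong: if_cong)
  qed
  ultimately have "\<exists>f. odd_map n (vietoris_rips (round_sphere m) (arccos (- \<kappa>))) vr_antipode f"
    unfolding odd_map_def by blast
  then show ?thesis unfolding coindex_def by (intro SUP_upper) simp
qed

lemma coindex_threshold_239_30000: "coindex_threshold 239 30000 / 2 < ereal (pi / 3)"
proof -
  let ?r = "arccos (- (4 / 13))"
  have "prime (13::nat)" by simp
  then obtain v :: "nat \<Rightarrow> nat \<Rightarrow> real" where v: "\<And>i. i < 30001 \<Longrightarrow> v i \<in> topspace (nsphere 239)"
    "\<And>i j. \<lbrakk>i < 30001; j < 30001; i \<noteq> j\<rbrakk> \<Longrightarrow> \<bar>\<Sum>k\<le>239. v i k * v j k\<bar> \<le> real 4 / real 13"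
    by (rule reed_solomon_directions[of 13 239 30001 4]) auto
  have "enat 30000 \<le> coindex (vietoris_rips (round_sphere 239) ?r) vr_antipode"
    by (rule coindex_vietoris_rips_ge[of 30000 v]) (use v in auto)
  then have "coindex_threshold 239 30000 \<le> ereal ?r"
    unfolding coindex_threshold_def by (intro INF_lower) (auto simp: arccos_lbound)
  then have "coindex_threshold 239 30000 / 2 \<le> ereal ?r / 2"
    by (rule ereal_divide_right_mono) auto
  also have "\<dots> = ereal (?r / 2)" by simp
  also have "\<dots> < ereal (pi / 3)"
  proof -
    have "?r < arccos (- (1 / 2))" by (intro arccos_less_arccos) auto
    also have "\<dots> = 2 * pi / 3"
      using arccos_cos[of "2 * pi / 3"] by (simp add: cos_120)
    finally show ?thesis by simp
  qed
  finally show ?thesis .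
qed

section \<open>The spheres of dimensions 239 and 30000\<close>

text \<open>Scale \<open>3 pi / 4\<close> on the large sphere meets scale \<open>3 pi / 4 - \<delta> > 11 pi / 400\<close> on the small one.\<close>
lemma chi_interleaving_dist_239_30000_ge:
  "ereal (289 * pi / 400) \<le> chi_interleaving_dist (round_sphere 239) (round_sphere 30000)"
  unfolding chi_interleaving_dist_def
proof (rule INF_greatest)
  fix \<delta>
  assume "\<delta> \<in> {\<delta>. 0 \<le> \<delta> \<and> (\<forall>u>\<delta>.
      borsuk_chi (round_sphere 239) u \<le> borsuk_chi (round_sphere 30000) (u - \<delta>) \<and>
      borsuk_chi (round_sphere 30000) u \<le> borsuk_chi (round_sphere 239) (u - \<delta>))}"
  then have \<delta>: "borsuk_chi (round_sphere 30000) u \<le> borsuk_chi (round_sphere 239) (u - \<delta>)"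
    if "\<delta> < u" for u using that by blast
  show "ereal (289 * pi / 400) \<le> ereal \<delta>"
  proof (rule ccontr)
    assume "\<not> ?thesis"
    then have less: "\<delta> < 289 * pi / 400" by simp
    have "enat (361 ^ 240) < borsuk_chi (round_sphere 30000) (3 * pi / 4)"
      by (rule borsuk_chi_sphere_30000_gt)
    also have "\<dots> \<le> borsuk_chi (round_sphere 239) (3 * pi / 4 - \<delta>)"
    proof (rule \<delta>)
      show "\<delta> < 3 * pi / 4" using less pi_gt_zero by linarith
    qed
    also have "\<dots> \<le> enat (361 ^ 240)"
      by (rule borsuk_chi_sphere_239_le) (use less in linarith)
    finally show False by (simp only: order_less_irrefl)
  qed
qed

theorem theoremC3:
  shows "gh_dist (round_sphere 239) (round_sphere 30000)
           \<ge> chi_interleaving_dist (round_sphere 239) (round_sphere 30000) / 2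
       \<and> chi_interleaving_dist (round_sphere 239) (round_sphere 30000) / 2
           \<ge> ereal (289 * pi / 800)
       \<and> 289 * pi / 800 > pi / 3
       \<and> ereal (pi / 3) > coindex_threshold 239 30000 / 2"
proof (intro conjI)
  let ?I = "chi_interleaving_dist (round_sphere 239) (round_sphere 30000)"
  have "(\<lambda>i. if i = 0 then 1 else 0) \<in> topspace (nsphere 239)"
    by (simp add: mem_nsphere if_distrib[of "\<lambda>z::real. z ^ 2"] sum.delta cong: if_cong)
  then show "gh_dist (round_sphere 239) (round_sphere 30000) \<ge> ?I / 2"
    by (intro chi_interleaving_dist_le_gh_dist) auto
  have "ereal (289 * pi / 800) = ereal (289 * pi / 400) / 2" by simp
  also have "\<dots> \<le> ?I / 2"
    by (rule ereal_divide_right_mono[OF chi_interleaving_dist_239_30000_ge]) simp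
  finally show "?I / 2 \<ge> ereal (289 * pi / 800)" .
  show "289 * pi / 800 > pi / 3" using pi_gt_zero by linarith
  show "ereal (pi / 3) > coindex_threshold 239 30000 / 2"
    by (rule coindex_threshold_239_30000)
qed

end
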